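(* Let $g$ be a Carmichael polynomial in $\mathbb{F}_q[t]$. Then $g$ is Carmichael in every finite Galois extension $K$ of $\mathbb{F}_q(t)$ whose discriminant is relatively prime to $g$.
   Context: $\mathbb{F}_q$ is the finite field with $q$ elements. A finite ring $S$ is a Carmichael ring if $S$ is not a field and $a^{|S|}=a$ for every $a\in S$; an ideal $I$ of a ring $R$ is a Carmichael ideal if $R/I$ is a Carmichael ring. A polynomial $g\in\mathbb{F}_q[t]$ is a Carmichael polynomial if $(g)$ is a Carmichael ideal of $\mathbb{F}_q[t]$. For a finite extension $K$ of $\mathbb{F}_q(t)$, $\mathcal{O}_K$ denotes the integral closure of $\mathbb{F}_q[t]$ in $K$, and an element $\alpha\in\mathcal{O}_K$ is Carmichael in $K$ if $\alpha\mathcal{O}_K$ is a Carmichael ideal of $\mathcal{O}_K$. The discriminant of $K$ is the discriminant ideal of $\mathcal{O}_K$ over $\mathbb{F}_q[t]$; "relatively prime to $g$" means no irreducible factor of $g$ divides it. *)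

theory Defs
  imports "HOL-Computational_Algebra.Polynomial_Factorial" "HOL-Algebra.QuotRing"
    "HOL-Combinatorics.Permutations"
begin

definition carmichael_ring :: "('a, 'b) ring_scheme \<Rightarrow> bool" where
  "carmichael_ring S \<longleftrightarrow> finite (carrier S) \<and> \<not> field S \<and>
     (\<forall>a \<in> carrier S. a [^]\<^bsub>S\<^esub> card (carrier S) = a)"

definition carmichael_ideal :: "('a, 'b) ring_scheme \<Rightarrow> 'a set \<Rightarrow> bool" where
  "carmichael_ideal R I \<longleftrightarrow> carmichael_ring (R Quot I)"

definition subring_struct :: "'a::comm_ring_1 set \<Rightarrow> 'a ring" where
  "subring_struct A = \<lparr>carrier = A, mult = (*), one = 1, zero = 0, add = (+)\<rparr>"

definition poly_ring :: "('f::{finite,field}) poly ring" where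
  "poly_ring = subring_struct UNIV"

definition carmichael_poly :: "('f::{finite,field}) poly \<Rightarrow> bool" where
  "carmichael_poly g \<longleftrightarrow> carmichael_ideal poly_ring (Idl\<^bsub>poly_ring\<^esub> {g})"

text \<open>A field extension K/F_q(t) is given by a field type 'k together with a field
  homomorphism emb from F_q(t) = 'f poly fract into 'k.\<close>

definition field_hom :: "('a::field \<Rightarrow> 'b::field) \<Rightarrow> bool" where
  "field_hom e \<longleftrightarrow> e 1 = 1 \<and> (\<forall>x y. e (x + y) = e x + e y) \<and> (\<forall>x y. e (x * y) = e x * e y)"

definition base_field :: "('f::{finite,field} poly fract \<Rightarrow> 'k::field) \<Rightarrow> 'k set" where
  "base_field emb = range emb"

definition is_basis ::
  "('f::{finite,field} poly fract \<Rightarrow> 'k::field) \<Rightarrow> nat \<Rightarrow> (nat \<Rightarrow> 'k) \<Rightarrow> bool" where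
  "is_basis emb n b \<longleftrightarrow>
     (\<forall>x. \<exists>c. (\<forall>i<n. c i \<in> base_field emb) \<and> x = (\<Sum>i<n. c i * b i)) \<and>
     (\<forall>c. (\<forall>i<n. c i \<in> base_field emb) \<and> (\<Sum>i<n. c i * b i) = 0 \<longrightarrow> (\<forall>i<n. c i = 0))"

definition finite_ext :: "('f::{finite,field} poly fract \<Rightarrow> 'k::field) \<Rightarrow> bool" where
  "finite_ext emb \<longleftrightarrow> (\<exists>n b. is_basis emb n b)"

definition ext_degree :: "('f::{finite,field} poly fract \<Rightarrow> 'k::field) \<Rightarrow> nat" where
  "ext_degree emb = (THE n. \<exists>b. is_basis emb n b)"

definition ext_basis :: "('f::{finite,field} poly fract \<Rightarrow> 'k::field) \<Rightarrow> nat \<Rightarrow> 'k" where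
  "ext_basis emb = (SOME b. is_basis emb (ext_degree emb) b)"

definition ext_auts :: "('f::{finite,field} poly fract \<Rightarrow> 'k::field) \<Rightarrow> ('k \<Rightarrow> 'k) set" where
  "ext_auts emb = {\<sigma>. bij \<sigma> \<and> field_hom \<sigma> \<and> (\<forall>x \<in> base_field emb. \<sigma> x = x)}"

definition galois_ext :: "('f::{finite,field} poly fract \<Rightarrow> 'k::field) \<Rightarrow> bool" where
  "galois_ext emb \<longleftrightarrow> finite_ext emb \<and> finite (ext_auts emb) \<and>
     card (ext_auts emb) = ext_degree emb"

text \<open>Coordinates w.r.t. the chosen basis, and the trace K \<rightarrow> F_q(t) (as an element of K),
  i.e. the trace of the F_q(t)-linear multiplication map.\<close>
definition coord :: "('f::{finite,field} poly fract \<Rightarrow> 'k::field) \<Rightarrow> 'k \<Rightarrow> nat \<Rightarrow> 'k" where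
  "coord emb y = (SOME c. (\<forall>i<ext_degree emb. c i \<in> base_field emb) \<and>
                       y = (\<Sum>i<ext_degree emb. c i * ext_basis emb i))"

definition ext_trace :: "('f::{finite,field} poly fract \<Rightarrow> 'k::field) \<Rightarrow> 'k \<Rightarrow> 'k" where
  "ext_trace emb x = (\<Sum>i<ext_degree emb. coord emb (x * ext_basis emb i) i)"

definition poly_emb :: "('f::{finite,field} poly fract \<Rightarrow> 'k::field) \<Rightarrow> 'f poly \<Rightarrow> 'k" where
  "poly_emb emb a = emb (to_fract a)"

definition ring_of_integers :: "('f::{finite,field} poly fract \<Rightarrow> 'k::field) \<Rightarrow> 'k set" where
  "ring_of_integers emb =
     {x. \<exists>n (a :: nat \<Rightarrow> 'f poly). x ^ n + (\<Sum>i<n. poly_emb emb (a i) * x ^ i) = 0}"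

definition O_ring :: "('f::{finite,field} poly fract \<Rightarrow> 'k::field) \<Rightarrow> 'k ring" where
  "O_ring emb = subring_struct (ring_of_integers emb)"

definition carmichael_in :: "('f::{finite,field} poly fract \<Rightarrow> 'k::field) \<Rightarrow> 'k \<Rightarrow> bool" where
  "carmichael_in emb \<alpha> \<longleftrightarrow> \<alpha> \<in> ring_of_integers emb \<and>
     carmichael_ideal (O_ring emb) (Idl\<^bsub>O_ring emb\<^esub> {\<alpha>})"

definition det_n :: "nat \<Rightarrow> (nat \<Rightarrow> nat \<Rightarrow> 'a::comm_ring_1) \<Rightarrow> 'a" where
  "det_n n A = (\<Sum>p | p permutes {..<n}. of_int (sign p) * (\<Prod>i<n. A i (p i)))"

definition discriminant_ideal :: "('f::{finite,field} poly fract \<Rightarrow> 'k::field) \<Rightarrow> 'f poly set" where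
  "discriminant_ideal emb = Idl\<^bsub>poly_ring\<^esub>
     {d. \<exists>x. (\<forall>i<ext_degree emb. x i \<in> ring_of_integers emb) \<and>
           poly_emb emb d = det_n (ext_degree emb) (\<lambda>i j. ext_trace emb (x i * x j))}"

definition rel_prime_ideal :: "'f::{finite,field} poly set \<Rightarrow> 'f poly \<Rightarrow> bool" where
  "rel_prime_ideal I g \<longleftrightarrow> (\<forall>p. irreducible p \<and> p dvd g \<longrightarrow> \<not> (\<forall>d \<in> I. p dvd d))"

end

theory Submission
  imports "Jordan_Normal_Form.Char_Poly" Defs "HOL-Algebra.Multiplicative_Group" "HOL-Algebra.Sylow"
begin

text \<open>Let \<open>Q\<close> be the cardinality of the residue ring of \<open>g\<close> and \<open>n\<close> the degree of the extension.
  Since the discriminant is prime to \<open>g\<close>, the Chinese remainder theorem yields integers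
  \<open>x\<^sub>0, \<dots>, x\<^sub>n\<^sub>-\<^sub>1\<close> whose discriminant is a unit modulo \<open>g\<close>. They form a basis of
  \<open>\<O>/g\<O>\<close> over the residue ring of \<open>g\<close>, so \<open>\<O>/g\<O>\<close> has \<open>Q ^ n\<close> elements, and the matrix of
  conjugates \<open>\<sigma>\<^sub>j x\<^sub>i\<close> is invertible modulo \<open>g\<close>. Because \<open>g\<close> is Carmichael, \<open>\<phi> y = y ^ Q\<close> is linear
  over polynomials modulo \<open>g\<close>; hence \<open>\<phi> = \<Sum>\<^sub>j c\<^sub>j \<sigma>\<^sub>j\<close> modulo \<open>g\<close>. Comparing \<open>\<phi> (z y)\<close> with
  \<open>\<phi> z * \<phi> y\<close> gives \<open>c\<^sub>j \<phi> = c\<^sub>j \<sigma>\<^sub>j\<close>, and \<open>\<sigma>\<^sub>j ^ n = 1\<close> together with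
  \<open>\<Sum>\<^sub>j c\<^sub>j = \<phi> 1 = 1\<close> yields \<open>\<phi> ^ n = 1\<close>. No factorisation of \<open>g\<close> in \<open>\<O>\<close> is needed.\<close>

hide_const (open) Ring_Hom.field_hom

section \<open>Finite abelian groups of prime exponent\<close>

lemma prime_power_if_unique_prime_factor:
  fixes n p :: nat
  assumes "n > 0" "prime p" "\<And>r. prime r \<Longrightarrow> r dvd n \<Longrightarrow> r = p"
  shows "\<exists>k. n = p ^ k"
proof -
  have "\<not> is_unit p" using assms(2) by auto
  with assms(1) obtain m where m: "n = p ^ multiplicity p n * m" "\<not> p dvd m"
    using multiplicity_decompose'[of n p] by (metis mult.commute less_not_refl)
  have "m = 1"
  proof (rule ccontr)
    assume "m \<noteq> 1"
    then obtain r where r: "prime r" "r dvd m" using prime_factor_nat by blast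
    then have "r dvd n" using m(1) by (metis dvd_mult)
    then show False using assms(3) r m(2) by blast
  qed
  then show ?thesis using m(1) by auto
qed

text \<open>By Cauchy's theorem every prime \<open>r\<close> dividing the order is the order of a
  subgroup; a nontrivial element of it has order dividing both \<open>r\<close> and
  \<open>p\<close>, which forces \<open>r = p\<close>.\<close>

lemma (in group) order_prime_power_if_prime_exponent:
  assumes fin: "finite (carrier G)" and p: "prime p"
    and exp: "\<And>x. x \<in> carrier G \<Longrightarrow> x [^] p = \<one>"
  shows "\<exists>k. order G = p ^ k"
proof (rule prime_power_if_unique_prime_factor)
  show "order G > 0" using fin order_gt_0_iff_finite by blast
  show "prime p" by fact
  fix r assume r: "prime r" "r dvd order G"
  \<comment> \<open>Sylow's theorem applies to any power of \<open>r\<close> dividing the order;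
    exponent 1 gives Cauchy's theorem.\<close>
  obtain m where m: "order G = r ^ 1 * m" using r(2) by (auto elim: dvdE)
  obtain H where H: "subgroup H G" "card H = r ^ 1"
    using sylow_thm[OF r(1) is_group m fin] by blast
  interpret H: group "G\<lparr>carrier := H\<rparr>" using H(1) by (rule subgroup_imp_group)
  have "card H > 1" using H(2) r(1) prime_gt_1_nat by auto
  then have "\<not> H \<subseteq> {\<one>}" using card_mono[of "{\<one>}" H] by auto
  then obtain x where x: "x \<in> H" "x \<noteq> \<one>" by blast
  have xG: "x \<in> carrier G" using subgroup.mem_carrier[OF H(1) x(1)] .
  have "x [^]\<^bsub>G\<lparr>carrier := H\<rparr>\<^esub> order (G\<lparr>carrier := H\<rparr>) = \<one>"
    using H.pow_order_eq_1[of x] x by simp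
  then have "x [^] r = \<one>" using H(2) nat_pow_consistent[of x r H] by (simp add: order_def)
  then have "ord x dvd r" using pow_eq_id[OF xG] by simp
  moreover have "ord x dvd p" using exp[OF xG] pow_eq_id[OF xG, THEN iffD1] by blast
  moreover have "ord x \<noteq> 1" using x(2) ord_eq_1[OF xG] by blast
  ultimately show "r = p" using r(1) p by (metis primes_dvd_imp_eq prime_nat_iff)
qed

section \<open>Quotients of subrings by principal ideals\<close>

text \<open>Rings are subsets of a ring type, so that the polynomials (with \<open>A = UNIV\<close>)
  and the integers inside the field \<open>'k\<close> both use the arithmetic of their type.\<close>

locale subring_set =
  fixes A :: "'a::comm_ring_1 set"
  assumes one_closed [intro, simp]: "1 \<in> A"
    and add_closed [intro]: "\<And>x y. x \<in> A \<Longrightarrow> y \<in> A \<Longrightarrow> x + y \<in> A"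
    and mult_closed [intro]: "\<And>x y. x \<in> A \<Longrightarrow> y \<in> A \<Longrightarrow> x * y \<in> A"
    and uminus_closed [intro]: "\<And>x. x \<in> A \<Longrightarrow> - x \<in> A"
begin

lemma zero_closed [intro, simp]: "0 \<in> A"
  using add_closed[OF one_closed uminus_closed[OF one_closed]] by simp

lemma diff_closed [intro]: "x \<in> A \<Longrightarrow> y \<in> A \<Longrightarrow> x - y \<in> A"
  using add_closed[of x "- y"] uminus_closed[of y] by simp

lemma power_closed [intro]: "x \<in> A \<Longrightarrow> x ^ n \<in> A"
  by (induction n) auto

lemma sum_closed: "(\<And>i. i \<in> I \<Longrightarrow> f i \<in> A) \<Longrightarrow> sum f I \<in> A"
  by (induction I rule: infinite_finite_induct) auto

lemma prod_closed: "(\<And>i. i \<in> I \<Longrightarrow> f i \<in> A) \<Longrightarrow> prod f I \<in> A"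
  by (induction I rule: infinite_finite_induct) auto

lemma cring_subring_struct: "cring (subring_struct A)"
proof (rule cringI)
  show "abelian_group (subring_struct A)"
  proof (rule abelian_groupI)
    fix x assume "x \<in> carrier (subring_struct A)"
    then show "\<exists>y\<in>carrier (subring_struct A). y \<oplus>\<^bsub>subring_struct A\<^esub> x = \<zero>\<^bsub>subring_struct A\<^esub>"
      by (intro bexI[of _ "- x"]) (auto simp: subring_struct_def)
  qed (auto simp: subring_struct_def add_ac)
  show "Group.comm_monoid (subring_struct A)"
    by (rule comm_monoidI) (auto simp: subring_struct_def mult_ac)
qed (auto simp: subring_struct_def distrib_right)

text \<open>The cofactor \<open>z\<close> has to lie in \<open>A\<close>; if it could be any element
  of an ambient field, all elements would be congruent modulo a nonzero \<alpha>.\<close>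

definition cong_mod :: "'a \<Rightarrow> 'a \<Rightarrow> 'a \<Rightarrow> bool" where
  "cong_mod \<alpha> x y \<longleftrightarrow> (\<exists>z\<in>A. x - y = \<alpha> * z)"

lemma cong_mod_refl [simp]: "cong_mod \<alpha> x x"
  unfolding cong_mod_def by (intro bexI[of _ 0]) auto

lemma cong_mod_sym: "cong_mod \<alpha> x y \<Longrightarrow> cong_mod \<alpha> y x"
  unfolding cong_mod_def by (metis minus_diff_eq mult_minus_right uminus_closed)

lemma cong_mod_trans [trans]: "cong_mod \<alpha> x y \<Longrightarrow> cong_mod \<alpha> y z \<Longrightarrow> cong_mod \<alpha> x z"
  unfolding cong_mod_def
proof (elim bexE)
  fix a b assume "a \<in> A" "b \<in> A" "x - y = \<alpha> * a" "y - z = \<alpha> * b"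
  then show "\<exists>c\<in>A. x - z = \<alpha> * c"
    by (intro bexI[of _ "a + b"]) (auto simp: algebra_simps)
qed

lemma cong_mod_add: "cong_mod \<alpha> x y \<Longrightarrow> cong_mod \<alpha> u v \<Longrightarrow> cong_mod \<alpha> (x + u) (y + v)"
  unfolding cong_mod_def
proof (elim bexE)
  fix a b assume "a \<in> A" "b \<in> A" "x - y = \<alpha> * a" "u - v = \<alpha> * b"
  then show "\<exists>c\<in>A. x + u - (y + v) = \<alpha> * c"
    by (intro bexI[of _ "a + b"]) (auto simp: algebra_simps)
qed

lemma cong_mod_mult_left: "c \<in> A \<Longrightarrow> cong_mod \<alpha> x y \<Longrightarrow> cong_mod \<alpha> (c * x) (c * y)"
  unfolding cong_mod_def
proof (elim bexE)
  fix a assume "c \<in> A" "a \<in> A" "x - y = \<alpha> * a"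
  then show "\<exists>b\<in>A. c * x - c * y = \<alpha> * b"
    by (intro bexI[of _ "c * a"]) (auto simp: right_diff_distrib[symmetric] mult_ac)
qed

lemma cong_mod_mult_right: "c \<in> A \<Longrightarrow> cong_mod \<alpha> x y \<Longrightarrow> cong_mod \<alpha> (x * c) (y * c)"
  using cong_mod_mult_left[of c \<alpha> x y] by (simp add: mult.commute)

lemma cong_mod_sum:
  "(\<And>i. i \<in> I \<Longrightarrow> cong_mod \<alpha> (f i) (f' i)) \<Longrightarrow> cong_mod \<alpha> (sum f I) (sum f' I)"
  by (induction I rule: infinite_finite_induct) (auto intro: cong_mod_add)

lemma cong_mod_diff_iff: "cong_mod \<alpha> (x - y) 0 \<longleftrightarrow> cong_mod \<alpha> x y"
  by (simp add: cong_mod_def)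

abbreviation quotient_by :: "'a \<Rightarrow> 'a set ring" where
  "quotient_by \<alpha> \<equiv> subring_struct A Quot (Idl\<^bsub>subring_struct A\<^esub> {\<alpha>})"

context
  fixes \<alpha>
  assumes \<alpha>: "\<alpha> \<in> A"
begin

interpretation R: cring "subring_struct A"
  by (rule cring_subring_struct)

lemma principal_ideal_eq: "Idl\<^bsub>subring_struct A\<^esub> {\<alpha>} = {\<alpha> * z |z. z \<in> A}"
  using R.cgenideal_eq_genideal[of \<alpha>] \<alpha>
  by (auto simp: cgenideal_def subring_struct_def mult.commute)

interpretation I: ideal "Idl\<^bsub>subring_struct A\<^esub> {\<alpha>}" "subring_struct A"
  by (rule R.genideal_ideal) (use \<alpha> in \<open>simp add: subring_struct_def\<close>)

interpretation Q: cring "quotient_by \<alpha>"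
  by (rule I.quotient_is_cring) (rule cring_subring_struct)

definition residue_class :: "'a \<Rightarrow> 'a set" where
  "residue_class x = {y. cong_mod \<alpha> y x}"

lemma residue_class_eq_coset:
  "x \<in> A \<Longrightarrow> Idl\<^bsub>subring_struct A\<^esub> {\<alpha>} +>\<^bsub>subring_struct A\<^esub> x = residue_class x"
  unfolding a_r_coset_def r_coset_def principal_ideal_eq residue_class_def cong_mod_def
  by (auto simp: subring_struct_def algebra_simps)

lemma residue_class_eq_iff: "residue_class x = residue_class y \<longleftrightarrow> cong_mod \<alpha> x y"
  unfolding residue_class_def using cong_mod_trans cong_mod_sym cong_mod_refl by blast

lemma carrier_quotient: "carrier (quotient_by \<alpha>) = residue_class ` A"
  using residue_class_eq_coset
  by (auto simp: FactRing_def A_RCOSETS_def' subring_struct_def image_iff)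

lemma quotient_mult:
  "x \<in> A \<Longrightarrow> y \<in> A \<Longrightarrow> residue_class x \<otimes>\<^bsub>quotient_by \<alpha>\<^esub> residue_class y = residue_class (x * y)"
  using I.rcoset_mult_add[of x y] residue_class_eq_coset[of x] residue_class_eq_coset[of y]
    residue_class_eq_coset[of "x * y"]
  by (auto simp: FactRing_def subring_struct_def)

lemma quotient_add:
  "x \<in> A \<Longrightarrow> y \<in> A \<Longrightarrow> residue_class x \<oplus>\<^bsub>quotient_by \<alpha>\<^esub> residue_class y = residue_class (x + y)"
  using I.a_rcos_sum[of x y] residue_class_eq_coset[of x] residue_class_eq_coset[of y]
    residue_class_eq_coset[of "x + y"]
  by (auto simp: FactRing_def subring_struct_def)

lemma quotient_one: "\<one>\<^bsub>quotient_by \<alpha>\<^esub> = residue_class 1"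
  using residue_class_eq_coset[of 1] by (auto simp: FactRing_def subring_struct_def)

lemma quotient_zero: "\<zero>\<^bsub>quotient_by \<alpha>\<^esub> = residue_class 0"
  using principal_ideal_eq
  by (auto simp: FactRing_def residue_class_def cong_mod_def)

lemma quotient_power:
  "x \<in> A \<Longrightarrow> residue_class x [^]\<^bsub>quotient_by \<alpha>\<^esub> (n::nat) = residue_class (x ^ n)"
  by (induction n) (auto simp: quotient_one quotient_mult power_closed mult.commute)

lemma quotient_nat_multiple:
  "x \<in> A \<Longrightarrow> residue_class x [^]\<^bsub>add_monoid (quotient_by \<alpha>)\<^esub> (n::nat) = residue_class (of_nat n * x)"
proof (induction n)
  case 0
  then show ?case by (simp add: quotient_zero nat_pow_def)
next
  case (Suc n)
  have "of_nat n * x \<in> A" using Suc.prems by (induction n) (auto simp: distrib_right)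
  then show ?case
    using Suc quotient_add[of "of_nat n * x" x] by (simp add: distrib_right add.commute nat_pow_def)
qed

lemma field_quotient_iff:
  "field (quotient_by \<alpha>) \<longleftrightarrow>
     \<not> cong_mod \<alpha> 1 0 \<and> (\<forall>a\<in>A. \<not> cong_mod \<alpha> a 0 \<longrightarrow> (\<exists>b\<in>A. cong_mod \<alpha> (a * b) 1))"
  (is "_ \<longleftrightarrow> ?r")
proof
  assume "field (quotient_by \<alpha>)"
  then interpret F: field "quotient_by \<alpha>" .
  show ?r
  proof (intro conjI ballI impI)
    show "\<not> cong_mod \<alpha> 1 0"
      using F.one_not_zero by (simp add: quotient_one quotient_zero residue_class_eq_iff)
    fix a assume a: "a \<in> A" "\<not> cong_mod \<alpha> a 0"
    then have "residue_class a \<in> carrier (quotient_by \<alpha>) - {\<zero>\<^bsub>quotient_by \<alpha>\<^esub>}"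
      using carrier_quotient by (auto simp: quotient_zero residue_class_eq_iff)
    then have "residue_class a \<in> Units (quotient_by \<alpha>)" using F.field_Units by simp
    then obtain b where "b \<in> A"
      "residue_class a \<otimes>\<^bsub>quotient_by \<alpha>\<^esub> residue_class b = \<one>\<^bsub>quotient_by \<alpha>\<^esub>"
      unfolding Units_def carrier_quotient by auto
    with a show "\<exists>b\<in>A. cong_mod \<alpha> (a * b) 1"
      by (auto simp: quotient_mult quotient_one residue_class_eq_iff)
  qed
next
  assume r: ?r
  show "field (quotient_by \<alpha>)"
  proof (rule Q.cring_fieldI2)
    show "\<zero>\<^bsub>quotient_by \<alpha>\<^esub> \<noteq> \<one>\<^bsub>quotient_by \<alpha>\<^esub>"
      using r cong_mod_sym by (auto simp: quotient_one quotient_zero residue_class_eq_iff)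
    fix x assume "x \<in> carrier (quotient_by \<alpha>)" "x \<noteq> \<zero>\<^bsub>quotient_by \<alpha>\<^esub>"
    then obtain a where a: "a \<in> A" "x = residue_class a" "residue_class a \<noteq> residue_class 0"
      unfolding carrier_quotient quotient_zero by blast
    then have "\<not> cong_mod \<alpha> a 0" using residue_class_eq_iff by blast
    with a r obtain b where "b \<in> A" "cong_mod \<alpha> (a * b) 1" by blast
    with a show "\<exists>b\<in>carrier (quotient_by \<alpha>). x \<otimes>\<^bsub>quotient_by \<alpha>\<^esub> b = \<one>\<^bsub>quotient_by \<alpha>\<^esub>"
      by (intro bexI[of _ "residue_class b"])
        (auto simp: quotient_mult quotient_one residue_class_eq_iff carrier_quotient)
  qed
qed

text \<open>With everything expressed by congruences, this unpacks the hypothesis on polynomials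
  and, read backwards, yields the conclusion on integers.\<close>

lemma carmichael_ideal_iff:
  "carmichael_ideal (subring_struct A) (Idl\<^bsub>subring_struct A\<^esub> {\<alpha>}) \<longleftrightarrow>
     finite (carrier (quotient_by \<alpha>)) \<and> \<not> field (quotient_by \<alpha>) \<and>
     (\<forall>a\<in>A. cong_mod \<alpha> (a ^ card (carrier (quotient_by \<alpha>))) a)"
proof -
  have "(\<forall>x\<in>carrier (quotient_by \<alpha>). x [^]\<^bsub>quotient_by \<alpha>\<^esub> N = x) \<longleftrightarrow>
    (\<forall>a\<in>A. cong_mod \<alpha> (a ^ N) a)" for N :: nat
    by (auto simp: carrier_quotient quotient_power residue_class_eq_iff)
  then show ?thesis
    by (simp only: carmichael_ideal_def carmichael_ring_def)
qed

lemma quotient_representatives: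
  obtains R where "R \<subseteq> A" "bij_betw residue_class R (carrier (quotient_by \<alpha>))"
    "\<And>a. a \<in> A \<Longrightarrow> \<exists>r\<in>R. cong_mod \<alpha> a r"
    "\<And>r s. r \<in> R \<Longrightarrow> s \<in> R \<Longrightarrow> cong_mod \<alpha> r s \<Longrightarrow> r = s"
proof -
  obtain R where R: "R \<subseteq> A" "inj_on residue_class R" "residue_class ` A = residue_class ` R"
    by (metis subset_image_inj subset_refl)
  show ?thesis
  proof (rule that)
    show "R \<subseteq> A" by fact
    show "bij_betw residue_class R (carrier (quotient_by \<alpha>))"
      using R carrier_quotient by (simp add: bij_betw_def)
    show "\<exists>r\<in>R. cong_mod \<alpha> a r" if "a \<in> A" for a
    proof -
      have "residue_class a \<in> residue_class ` R" using that R(3) by blast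
      then show ?thesis using residue_class_eq_iff by auto
    qed
    show "r = s" if "r \<in> R" "s \<in> R" "cong_mod \<alpha> r s" for r s
      using that R(2) residue_class_eq_iff by (meson inj_onD)
  qed
qed

text \<open>Serves to count the residue ring of the integers by coordinate vectors.\<close>

lemma bij_betw_quotient:
  assumes "f ` S \<subseteq> A" "\<And>a. a \<in> A \<Longrightarrow> \<exists>s\<in>S. cong_mod \<alpha> a (f s)"
    "\<And>s t. s \<in> S \<Longrightarrow> t \<in> S \<Longrightarrow> cong_mod \<alpha> (f s) (f t) \<Longrightarrow> s = t"
  shows "bij_betw (\<lambda>s. residue_class (f s)) S (carrier (quotient_by \<alpha>))"
proof -
  have "residue_class a \<in> (\<lambda>s. residue_class (f s)) ` S" if "a \<in> A" for a
    using assms(2)[OF that] residue_class_eq_iff by (auto simp: image_iff)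
  moreover have "inj_on (\<lambda>s. residue_class (f s)) S"
    using assms(3) by (auto simp: inj_on_def residue_class_eq_iff)
  ultimately show ?thesis using assms(1) by (auto simp: bij_betw_def carrier_quotient)
qed

text \<open>The additive group of the quotient is killed by \<open>p\<close>, so its order is a
  power of \<open>p\<close>. In characteristic \<open>p\<close> this makes raising to the power of
  that order additive.\<close>

lemma card_quotient_prime_power:
  assumes fin: "finite (carrier (quotient_by \<alpha>))" and p: "prime p" "of_nat p = (0::'a)"
  shows "\<exists>k. card (carrier (quotient_by \<alpha>)) = p ^ k"
proof -
  have "x [^]\<^bsub>add_monoid (quotient_by \<alpha>)\<^esub> p = \<one>\<^bsub>add_monoid (quotient_by \<alpha>)\<^esub>"
    if x: "x \<in> carrier (quotient_by \<alpha>)" for x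
  proof -
    obtain a where "a \<in> A" "x = residue_class a" using x unfolding carrier_quotient by blast
    then show ?thesis using quotient_nat_multiple[of a p] p(2) by (simp add: quotient_zero)
  qed
  then show ?thesis
    using group.order_prime_power_if_prime_exponent[OF Q.add.is_group, of p] fin p(1)
    by (simp add: order_def)
qed

end

end

section \<open>Determinants and adjugates of function matrices\<close>

text \<open>Bridge from the function matrices used by \<open>det_n\<close> to the matrix type, whose
  theory of determinants and adjugates then applies.\<close>

definition mat_n :: "nat \<Rightarrow> (nat \<Rightarrow> nat \<Rightarrow> 'a::comm_ring_1) \<Rightarrow> 'a mat" where
  "mat_n n M = mat n n (\<lambda>(i, j). M i j)"

text \<open>The adjugate takes the place of an inverse, because the determinant of the conjugates
  will be invertible only modulo \<open>g\<close>.\<close>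

definition adj_n :: "nat \<Rightarrow> (nat \<Rightarrow> nat \<Rightarrow> 'a::comm_ring_1) \<Rightarrow> nat \<Rightarrow> nat \<Rightarrow> 'a" where
  "adj_n n M i j = adj_mat (mat_n n M) $$ (i, j)"

lemma mat_n_carrier [simp]: "mat_n n M \<in> carrier_mat n n"
  by (simp add: mat_n_def)

lemma mat_n_index [simp]: "i < n \<Longrightarrow> j < n \<Longrightarrow> mat_n n M $$ (i, j) = M i j"
  by (simp add: mat_n_def)

lemma det_mat_n: "det (mat_n n M) = det_n n M"
  unfolding det_def'[OF mat_n_carrier] det_n_def atLeast0LessThan
proof (intro sum.cong refl arg_cong2[where f = times] prod.cong)
  fix p i assume "p \<in> {p. p permutes {..<n}}" "i \<in> {..<n}"
  then show "mat_n n M $$ (i, p i) = M i (p i)"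
    using permutes_in_image[of p "{..<n}" i] by simp
qed

lemma mat_mult_index_sum:
  "B \<in> carrier_mat n n \<Longrightarrow> C \<in> carrier_mat n n \<Longrightarrow> i < n \<Longrightarrow> j < n \<Longrightarrow>
    (B * C) $$ (i, j) = (\<Sum>k<n. B $$ (i, k) * C $$ (k, j))"
  by (auto simp: scalar_prod_def atLeast0LessThan)

lemma mat_mult_adj_n:
  assumes "i < n" "j < n"
  shows "(\<Sum>k<n. M i k * adj_n n M k j) = (if i = j then det_n n M else 0)"
proof -
  have "(mat_n n M * adj_mat (mat_n n M)) $$ (i, j) = (\<Sum>k<n. M i k * adj_n n M k j)"
    using assms by (subst mat_mult_index_sum[of _ n]) (auto simp: adj_mat adj_n_def)
  then show ?thesis
    using assms by (auto simp: adj_mat(2)[OF mat_n_carrier] det_mat_n split: if_splits)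
qed

lemma adj_n_mult_mat:
  assumes "i < n" "j < n"
  shows "(\<Sum>k<n. adj_n n M i k * M k j) = (if i = j then det_n n M else 0)"
proof -
  have "(adj_mat (mat_n n M) * mat_n n M) $$ (i, j) = (\<Sum>k<n. adj_n n M i k * M k j)"
    using assms by (subst mat_mult_index_sum[of _ n]) (auto simp: adj_mat adj_n_def)
  then show ?thesis
    using assms by (auto simp: adj_mat(3)[OF mat_n_carrier] det_mat_n split: if_splits)
qed

text \<open>Cramer's rule without division; it provides existence of solutions once the determinant
  is invertible.\<close>

lemma adj_n_solves:
  assumes "i < n"
  shows "(\<Sum>k<n. M i k * (\<Sum>j<n. adj_n n M k j * v j)) = det_n n M * v i"
proof -
  have "(\<Sum>k<n. M i k * (\<Sum>j<n. adj_n n M k j * v j)) =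
      (\<Sum>k<n. \<Sum>j<n. M i k * adj_n n M k j * v j)"
    by (simp add: sum_distrib_left mult.assoc)
  also have "\<dots> = (\<Sum>j<n. (\<Sum>k<n. M i k * adj_n n M k j) * v j)"
    by (subst sum.swap) (simp add: sum_distrib_right)
  also have "\<dots> = (\<Sum>j<n. if i = j then det_n n M * v j else 0)"
    using assms by (intro sum.cong) (auto simp: mat_mult_adj_n)
  also have "\<dots> = det_n n M * v i"
    using assms by simp
  finally show ?thesis .
qed

text \<open>The counterpart for uniqueness: the adjugate recovers the unknown vector from its image,
  up to the determinant.\<close>

lemma adj_n_cancels:
  assumes "i < n"
  shows "(\<Sum>k<n. adj_n n M i k * (\<Sum>j<n. M k j * v j)) = det_n n M * v i"
proof -
  have "(\<Sum>k<n. adj_n n M i k * (\<Sum>j<n. M k j * v j)) =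
      (\<Sum>k<n. \<Sum>j<n. adj_n n M i k * M k j * v j)"
    by (simp add: sum_distrib_left mult.assoc)
  also have "\<dots> = (\<Sum>j<n. (\<Sum>k<n. adj_n n M i k * M k j) * v j)"
    by (subst sum.swap) (simp add: sum_distrib_right)
  also have "\<dots> = (\<Sum>j<n. if i = j then det_n n M * v j else 0)"
    using assms by (intro sum.cong) (auto simp: adj_n_mult_mat)
  also have "\<dots> = det_n n M * v i"
    using assms by simp
  finally show ?thesis .
qed

text \<open>The matrix on the left is \<open>M\<close> times its transpose. With the conjugates as
  \<open>M\<close> it becomes the matrix of the trace form.\<close>

lemma det_n_mult_transpose:
  "det_n n (\<lambda>i j. \<Sum>k<n. M i k * M j k) = (det_n n M)\<^sup>2"
proof -
  have "mat_n n (\<lambda>i j. \<Sum>k<n. M i k * M j k) = mat_n n M * transpose_mat (mat_n n M)"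
    by (rule eq_matI) (auto simp: mat_n_def scalar_prod_def atLeast0LessThan)
  then have "det (mat_n n (\<lambda>i j. \<Sum>k<n. M i k * M j k)) = det (mat_n n M) * det (mat_n n M)"
    using det_mult[of "mat_n n M" n "transpose_mat (mat_n n M)"] det_transpose[OF mat_n_carrier, of n M]
    by simp
  then show ?thesis by (simp add: det_mat_n power2_eq_square)
qed

lemma det_n_eq_0_kernel:
  fixes M :: "nat \<Rightarrow> nat \<Rightarrow> 'a::field"
  assumes "det_n n M = 0"
  obtains v where "\<exists>j<n. v j \<noteq> 0" "\<And>i. i < n \<Longrightarrow> (\<Sum>j<n. M i j * v j) = 0"
proof -
  obtain w where w: "w \<in> carrier_vec n" "w \<noteq> 0\<^sub>v n" "mat_n n M *\<^sub>v w = 0\<^sub>v n"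
    using assms det_0_iff_vec_prod_zero_field[OF mat_n_carrier, of n M] by (auto simp: det_mat_n)
  show ?thesis
  proof (rule that[of "\<lambda>j. w $ j"])
    show "\<exists>j<n. w $ j \<noteq> 0"
      using w(1,2) by (metis carrier_vecD eq_vecI index_zero_vec)
    fix i assume i: "i < n"
    have "(mat_n n M *\<^sub>v w) $ i = (\<Sum>j<n. M i j * w $ j)"
      using w(1) i by (auto simp: scalar_prod_def mat_n_def atLeast0LessThan)
    then show "(\<Sum>j<n. M i j * w $ j) = 0" using w(3) i by simp
  qed
qed

lemma (in subring_set) det_closed:
  assumes "B \<in> carrier_mat m m" "\<And>i j. i < m \<Longrightarrow> j < m \<Longrightarrow> B $$ (i, j) \<in> A"
  shows "det B \<in> A"
  unfolding det_def'[OF assms(1)]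
proof (intro sum_closed mult_closed prod_closed)
  fix p assume p: "p \<in> {p. p permutes {0..<m}}"
  show "signof p \<in> A" by (auto simp: sign_def)
  fix i assume "i \<in> {0..<m}"
  then show "B $$ (i, p i) \<in> A"
    using p permutes_in_image[of p "{0..<m}" i] by (intro assms(2)) auto
qed

lemma (in subring_set) det_n_closed:
  "(\<And>i j. i < n \<Longrightarrow> j < n \<Longrightarrow> M i j \<in> A) \<Longrightarrow> det_n n M \<in> A"
  using det_closed[of "mat_n n M" n] by (simp add: det_mat_n)

text \<open>Each entry of the adjugate is a signed minor, hence an integer polynomial in the entries
  of \<open>M\<close>.\<close>

lemma (in subring_set) adj_n_closed:
  assumes "\<And>i j. i < n \<Longrightarrow> j < n \<Longrightarrow> M i j \<in> A" "i < n" "j < n"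
  shows "adj_n n M i j \<in> A"
proof -
  have "det (mat_delete (mat_n n M) j i) \<in> A"
  proof (rule det_closed)
    show "mat_delete (mat_n n M) j i \<in> carrier_mat (n - 1) (n - 1)"
      by (simp add: mat_n_def mat_delete_def)
    show "mat_delete (mat_n n M) j i $$ (k, l) \<in> A" if "k < n - 1" "l < n - 1" for k l
      using that assms by (auto simp: mat_n_def mat_delete_def)
  qed
  moreover have "(- 1) ^ (j + i) \<in> A" by auto
  ultimately show ?thesis
    using assms(2,3) by (auto simp: adj_n_def adj_mat_def mat_n_def cofactor_def)
qed

lemma det_n_hom:
  assumes "h 0 = 0" "h 1 = 1" "\<And>x y. h (x + y) = h x + h y" "\<And>x y. h (x * y) = h x * h y"
    "\<And>x. h (- x) = - h x"
  shows "h (det_n n M) = det_n n (\<lambda>i j. h (M i j))"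
proof -
  interpret comm_ring_hom h by standard (use assms in auto)
  show ?thesis
    by (simp add: det_n_def hom_sum hom_mult hom_prod)
qed

lemma det_n_dvd_diff:
  assumes "\<And>i j. i < n \<Longrightarrow> j < n \<Longrightarrow> a dvd M i j - N i j"
  shows "a dvd det_n n M - det_n n N"
proof -
  have prod: "a dvd prod f S - prod f' S" if "\<And>i. i \<in> S \<Longrightarrow> a dvd f i - f' i" for f f' and S :: "nat set"
    using that
  proof (induction S rule: infinite_finite_induct)
    case (insert x S)
    \<comment> \<open>The factors are exchanged one at a time.\<close>
    have "prod f (insert x S) - prod f' (insert x S) =
        f x * (prod f S - prod f' S) + (f x - f' x) * prod f' S"
      using insert.hyps by (simp add: algebra_simps)
    then show ?case using insert by simp
  qed auto
  have "a dvd of_int (sign p) * (\<Prod>i<n. M i (p i)) - of_int (sign p) * (\<Prod>i<n. N i (p i))"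
    if p: "p permutes {..<n}" for p
  proof -
    have "a dvd (\<Prod>i<n. M i (p i)) - (\<Prod>i<n. N i (p i))"
    proof (rule prod)
      fix i assume "i \<in> {..<n}"
      then show "a dvd M i (p i) - N i (p i)"
        using permutes_in_image[OF p, of i] by (intro assms) auto
    qed
    then show ?thesis by (simp add: right_diff_distrib[symmetric] dvd_mult)
  qed
  then show ?thesis
    by (auto simp: det_n_def sum_subtractf[symmetric] intro!: dvd_sum)
qed

section \<open>Bezout identities for polynomials over a field\<close>

text \<open>A nonzero combination \<open>d\<close> of least degree divides every combination, since
  the remainder is again a combination, of smaller degree.\<close>

lemma poly_bezout:
  fixes a b :: "'f::field poly"
  assumes "b \<noteq> 0"
  obtains u v d where "u * a + v * b = d" "d dvd a" "d dvd b"
proof -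
  define P where "P d \<longleftrightarrow> d \<noteq> 0 \<and> (\<exists>u v. u * a + v * b = d)" for d
  have "P b" unfolding P_def using assms by (metis add_0 mult_1 mult_zero_left)
  then obtain d where d: "P d" "\<And>e. P e \<Longrightarrow> degree d \<le> degree e"
    using ex_has_least_nat[of P b degree] by blast
  then obtain u v where uv: "u * a + v * b = d" "d \<noteq> 0" unfolding P_def by blast
  have dvd: "d dvd c" if c: "c = s * a + t * b" for c s t
  proof (rule ccontr)
    assume "\<not> d dvd c"
    then have nz: "c mod d \<noteq> 0" by (simp add: mod_eq_0_iff_dvd)
    have "c mod d = c - c div d * d" by (simp add: minus_div_mult_eq_mod)
    also have "\<dots> = (s - c div d * u) * a + (t - c div d * v) * b"
      by (simp add: c uv(1)[symmetric] algebra_simps)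
    finally have "P (c mod d)" unfolding P_def using nz by metis
    moreover have "degree (c mod d) < degree d" using degree_mod_less[OF uv(2), of c] nz by auto
    ultimately show False using d(2) by fastforce
  qed
  show ?thesis using that[OF uv(1)] dvd[of a 1 0] dvd[of b 0 1] by simp
qed

text \<open>A common divisor \<open>d\<close> of \<open>a\<close> and \<open>p\<close> that is a
  combination of both must be a unit: otherwise it is associated to \<open>p\<close>, and then
  \<open>p\<close> divides \<open>a\<close>. Scaling by its inverse gives 1.\<close>

lemma irreducible_not_dvd_bezout:
  fixes p a :: "'f::field poly"
  assumes "irreducible p" "\<not> p dvd a"
  obtains u v where "u * a + v * p = 1"
proof -
  have "p \<noteq> 0" using assms(1) by auto
  from poly_bezout[OF this, of a] obtain u v d
    where d: "u * a + v * p = d" "d dvd a" "d dvd p" by blast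
  from d(3) obtain e where e: "p = d * e" unfolding dvd_def by blast
  have "\<not> e dvd 1"
  proof
    assume "e dvd 1"
    then have "p dvd d" using e by (metis dvd_mult_cancel_left dvd_refl mult.right_neutral mult_dvd_mono)
    then show False using d(2) assms(2) dvd_trans by blast
  qed
  then have "d dvd 1" using irreducibleD[OF assms(1) e] by blast
  then obtain c where "d * c = 1" unfolding dvd_def by metis
  then have "(c * u) * a + (c * v) * p = 1" using d(1) by (metis distrib_left mult.assoc mult.commute)
  then show ?thesis by (rule that)
qed

lemma poly_irreducible_factor:
  fixes g :: "'f::field poly"
  assumes "g \<noteq> 0" "\<not> g dvd 1"
  obtains p where "irreducible p" "p dvd g"
  using assms
proof (induction "degree g" arbitrary: g thesis rule: less_induct)
  case less
  show ?case
  proof (cases "irreducible g")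
    case False
    then obtain a b where ab: "g = a * b" "\<not> a dvd 1" "\<not> b dvd 1"
      using less.prems unfolding irreducible_def by blast
    then have nz: "a \<noteq> 0" "b \<noteq> 0" using less.prems by auto
    have "degree b > 0" using ab(3) nz(2) is_unit_iff_degree by blast
    then have "degree a < degree g" using ab(1) nz by (simp add: degree_mult_eq)
    then show ?thesis using less.hyps[of a] ab nz less.prems(1) by (metis dvd_mult2)
  qed (use less.prems in auto)
qed

section \<open>The ring of integers\<close>

locale function_field_ext =
  fixes emb :: "'f::{finite,field} poly fract \<Rightarrow> 'k::field"
  assumes field_hom_emb: "Defs.field_hom emb"
begin

abbreviation "h \<equiv> poly_emb emb"
abbreviation "\<O> \<equiv> ring_of_integers emb"

lemma emb_1: "emb 1 = 1" and emb_add: "emb (x + y) = emb x + emb y"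
  and emb_mult: "emb (x * y) = emb x * emb y"
  using field_hom_emb by (auto simp: Defs.field_hom_def)

lemma emb_0: "emb 0 = 0"
  using emb_add[of 0 0] by (metis add.right_neutral add_left_cancel)

lemma emb_uminus: "emb (- x) = - emb x"
  using emb_add[of x "- x"] by (simp add: emb_0 eq_neg_iff_add_eq_0 add.commute)

lemma emb_eq_0_iff: "emb x = 0 \<longleftrightarrow> x = 0"
proof
  assume "emb x = 0"
  then have "emb (x * inverse x) = 0" by (simp add: emb_mult)
  then show "x = 0" using emb_1 by (metis right_inverse zero_neq_one)
qed (simp add: emb_0)

lemma h_0 [simp]: "h 0 = 0" and h_1 [simp]: "h 1 = 1"
  and h_add: "h (a + b) = h a + h b" and h_mult: "h (a * b) = h a * h b"
  and h_uminus: "h (- a) = - h a"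
  by (simp_all add: poly_emb_def emb_0 emb_1 emb_add emb_mult emb_uminus)

sublocale h: comm_ring_hom h
  by standard (auto simp: h_add h_mult h_uminus)

lemma h_eq_0_iff [simp]: "h a = 0 \<longleftrightarrow> a = 0"
  by (simp add: poly_emb_def emb_eq_0_iff)

lemma h_diff: "h (a - b) = h a - h b"
  using h_add[of a "- b"] by (simp add: h_uminus)

lemma h_eq_iff [simp]: "h a = h b \<longleftrightarrow> a = b"
  using h_eq_0_iff[of "a - b"] by (simp add: h_diff)

lemma h_in_base_field: "h a \<in> base_field emb"
  by (simp add: base_field_def poly_emb_def)

text \<open>The \<open>F_q[t]\<close>-submodule of the extension generated by \<open>v 0\<close>,
  ..., \<open>v (N - 1)\<close>.\<close>

definition poly_span :: "nat \<Rightarrow> (nat \<Rightarrow> 'k) \<Rightarrow> 'k set" where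
  "poly_span N v = {\<Sum>k<N. h (c k) * v k |c. True}"

lemma poly_spanI: "(\<Sum>k<N. h (c k) * v k) \<in> poly_span N v"
  unfolding poly_span_def by (rule CollectI) (intro exI[of _ c], simp)

lemma poly_span_add: "x \<in> poly_span N v \<Longrightarrow> y \<in> poly_span N v \<Longrightarrow> x + y \<in> poly_span N v"
proof -
  assume "x \<in> poly_span N v" "y \<in> poly_span N v"
  then obtain c d where "x = (\<Sum>k<N. h (c k) * v k)" "y = (\<Sum>k<N. h (d k) * v k)"
    unfolding poly_span_def by blast
  then have "x + y = (\<Sum>k<N. h (c k + d k) * v k)"
    by (simp add: h_add distrib_right sum.distrib)
  then show ?thesis by (simp only: poly_spanI)
qed

lemma poly_span_scale: "x \<in> poly_span N v \<Longrightarrow> h a * x \<in> poly_span N v"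
proof -
  assume "x \<in> poly_span N v"
  then obtain c where "x = (\<Sum>k<N. h (c k) * v k)"
    unfolding poly_span_def by blast
  then have "h a * x = (\<Sum>k<N. h (a * c k) * v k)"
    by (simp add: h_mult sum_distrib_left mult.assoc)
  then show ?thesis by (simp only: poly_spanI)
qed

lemma poly_span_base: "i < N \<Longrightarrow> v i \<in> poly_span N v"
proof -
  assume "i < N"
  then have "v i = (\<Sum>k<N. h (if k = i then 1 else 0) * v k)"
    by (simp add: if_distrib[of h] if_distrib[of "\<lambda>x. x * _"] cong: if_cong)
  then show ?thesis by (simp only: poly_spanI)
qed

lemma poly_span_0: "0 \<in> poly_span N v"
  using poly_spanI[of "\<lambda>_. 0"] by simp

lemma poly_span_sum: "(\<And>i. i \<in> I \<Longrightarrow> f i \<in> poly_span N v) \<Longrightarrow> sum f I \<in> poly_span N v"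
  by (induction I rule: infinite_finite_induct) (auto intro: poly_span_add poly_span_0)

lemma poly_span_mult:
  assumes "\<And>i. i < N \<Longrightarrow> x * v i \<in> poly_span N v" "s \<in> poly_span N v"
  shows "x * s \<in> poly_span N v"
proof -
  obtain c where "s = (\<Sum>k<N. h (c k) * v k)" using assms(2) unfolding poly_span_def by blast
  then have "x * s = (\<Sum>k<N. h (c k) * (x * v k))" by (simp add: sum_distrib_left mult_ac)
  then show ?thesis using assms(1) by (auto intro!: poly_span_sum poly_span_scale)
qed

lemma degree_map_poly_h: "degree (map_poly h p) = degree p"
  by (cases "p = 0") (auto intro!: map_poly_degree_eq)

text \<open>The determinant trick: multiplication by \<open>x\<close> on the span is described by a
  polynomial matrix, the generators form an eigenvector for the eigenvalue \<open>x\<close>, and the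
  monic characteristic polynomial is an integral equation. The nonzero generator makes the
  eigenvector nonzero.\<close>

lemma integral_if_stable_span:
  assumes nz: "i < N" "v i \<noteq> 0" and st: "\<And>i. i < N \<Longrightarrow> x * v i \<in> poly_span N v"
  shows "x \<in> \<O>"
proof -
  have "\<forall>i. \<exists>c. i < N \<longrightarrow> x * v i = (\<Sum>k<N. h (c k) * v k)"
    using st unfolding poly_span_def by blast
  then obtain a where a: "\<And>i. i < N \<Longrightarrow> x * v i = (\<Sum>k<N. h (a i k) * v k)"
    by metis
  define B where "B = mat_n N a"
  have B: "B \<in> carrier_mat N N" by (simp add: B_def)
  have "eigenvector (map_mat h B) (vec N v) x"
    unfolding eigenvector_def
  proof (intro conjI)
    show "vec N v \<in> carrier_vec (dim_row (map_mat h B))" using B by simp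
    show "vec N v \<noteq> 0\<^sub>v (dim_row (map_mat h B))"
      using nz B by (metis carrier_matD(1) index_map_mat(2) index_vec index_zero_vec(1))
    show "map_mat h B *\<^sub>v vec N v = x \<cdot>\<^sub>v vec N v"
      by (rule eq_vecI) (use a in \<open>auto simp: B_def mat_n_def scalar_prod_def atLeast0LessThan\<close>)
  qed
  then have "eigenvalue (map_mat h B) x" unfolding eigenvalue_def by blast
  then have "poly (char_poly (map_mat h B)) x = 0"
    using eigenvalue_root_char_poly[of "map_mat h B" N] B by simp
  then have root: "poly (map_poly h (char_poly B)) x = 0"
    using h.char_poly_hom[OF B] by simp
  have monic: "degree (char_poly B) = N" "Polynomial.coeff (char_poly B) N = 1"
    using degree_monic_char_poly[OF B] by auto
  then have "degree (map_poly h (char_poly B)) = N" by (simp add: degree_map_poly_h)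
  then have "(\<Sum>i\<le>N. h (Polynomial.coeff (char_poly B) i) * x ^ i) = 0"
    using root by (simp add: poly_altdef coeff_map_poly)
  then have "x ^ N + (\<Sum>i<N. h (Polynomial.coeff (char_poly B) i) * x ^ i) = 0"
    using monic by (simp add: lessThan_Suc_atMost[symmetric] add.commute)
  then show ?thesis unfolding ring_of_integers_def by blast
qed

text \<open>The products \<open>x ^ i * y ^ j\<close> with both exponents below the degrees of the
  integral equations span a module stable under \<open>x\<close> and \<open>y\<close>, hence also
  under their sum and product.\<close>

lemma integral_stable_span:
  assumes "x \<in> \<O>" "y \<in> \<O>"
  obtains N v i where "i < N" "v i \<noteq> 0"
    "\<And>i. i < N \<Longrightarrow> x * v i \<in> poly_span N v" "\<And>i. i < N \<Longrightarrow> y * v i \<in> poly_span N v"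
proof -
  obtain n a where a: "x ^ n + (\<Sum>i<n. h (a i) * x ^ i) = 0"
    using assms(1) unfolding ring_of_integers_def by blast
  obtain m b where b: "y ^ m + (\<Sum>i<m. h (b i) * y ^ i) = 0"
    using assms(2) unfolding ring_of_integers_def by blast
  \<comment> \<open>With exponent 0 the integral equation would read 1 = 0.\<close>
  have pos: "n > 0" "m > 0" using a b by (auto intro: gr0I)
  \<comment> \<open>The pair of exponents \<open>(i, j)\<close> is encoded as the single index
    \<open>i * m + j\<close>.\<close>
  define v where "v k = x ^ (k div m) * y ^ (k mod m)" for k
  have vij: "v (i * m + j) = x ^ i * y ^ j" if "j < m" for i j
    using that by (simp add: v_def)
  have inr: "i * m + j < n * m" if "i < n" "j < m" for i j
  proof -
    have "i * m + j < i * m + m" using that by simp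
    also have "\<dots> = Suc i * m" by simp
    also have "\<dots> \<le> n * m" using that by (intro mult_right_mono) auto
    finally show ?thesis .
  qed
  have base: "x ^ i * y ^ j \<in> poly_span (n * m) v" if "i < n" "j < m" for i j
    using poly_span_base[OF inr[OF that], of v] vij[OF that(2)] by simp
  have xn: "x ^ n = (\<Sum>i<n. h (- a i) * x ^ i)"
    using a by (simp add: h_uminus sum_negf eq_neg_iff_add_eq_0)
  have ym: "y ^ m = (\<Sum>i<m. h (- b i) * y ^ i)"
    using b by (simp add: h_uminus sum_negf eq_neg_iff_add_eq_0)
  \<comment> \<open>The boundary exponent \<open>n\<close> arises when \<open>x\<close> multiplies a
    product with \<open>x ^ (n - 1)\<close>; the integral equation reduces it to lower powers. The
    same holds for \<open>y\<close> in \<open>le_y\<close>.\<close>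
  have le_x: "x ^ i * y ^ j \<in> poly_span (n * m) v" if "i \<le> n" "j < m" for i j
  proof (cases "i = n")
    case True
    have "x ^ n * y ^ j = (\<Sum>i<n. h (- a i) * (x ^ i * y ^ j))"
      by (subst xn) (simp add: sum_distrib_right mult.assoc)
    also have "\<dots> \<in> poly_span (n * m) v"
      using that by (intro poly_span_sum poly_span_scale base) auto
    finally show ?thesis using True by simp
  qed (use that base in auto)
  have le_y: "x ^ i * y ^ j \<in> poly_span (n * m) v" if "i < n" "j \<le> m" for i j
  proof (cases "j = m")
    case True
    have "x ^ i * y ^ m = (\<Sum>j<m. h (- b j) * (x ^ i * y ^ j))"
      by (subst ym) (simp add: sum_distrib_left mult_ac)
    also have "\<dots> \<in> poly_span (n * m) v"
      using that by (intro poly_span_sum poly_span_scale base) auto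
    finally show ?thesis using True by simp
  qed (use that base in auto)
  have k: "k div m < n" "k mod m < m" if "k < n * m" for k
    using that pos by (auto simp: less_mult_imp_div_less)
  show ?thesis
  proof (rule that[of 0 "n * m" v])
    show "0 < n * m" using pos by simp
    show "v 0 \<noteq> 0" by (simp add: v_def)
    fix i assume i: "i < n * m"
    have "x * v i = x ^ Suc (i div m) * y ^ (i mod m)" by (simp add: v_def mult.assoc)
    then show "x * v i \<in> poly_span (n * m) v" using le_x k[OF i] by (metis Suc_leI)
    have "y * v i = x ^ (i div m) * y ^ Suc (i mod m)" by (simp add: v_def mult_ac)
    then show "y * v i \<in> poly_span (n * m) v" using le_y k[OF i] by (metis Suc_leI)
  qed
qed

lemma h_integral [simp]: "h a \<in> \<O>"
proof -
  have "h a ^ 1 + (\<Sum>i<1. h (- a) * h a ^ i) = 0" by (simp add: h_uminus)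
  then show ?thesis
    unfolding ring_of_integers_def mem_Collect_eq by (intro exI[of _ 1] exI[of _ "\<lambda>_. - a"])
qed

lemma integral_add: "x \<in> \<O> \<Longrightarrow> y \<in> \<O> \<Longrightarrow> x + y \<in> \<O>"
proof -
  assume "x \<in> \<O>" "y \<in> \<O>"
  from integral_stable_span[OF this] obtain N v i where *: "i < N" "v i \<noteq> 0"
    "\<And>i. i < N \<Longrightarrow> x * v i \<in> poly_span N v" "\<And>i. i < N \<Longrightarrow> y * v i \<in> poly_span N v" by metis
  show ?thesis
    by (rule integral_if_stable_span[of i N v, OF *(1,2)]) (auto simp: distrib_right intro: poly_span_add *)
qed

lemma integral_mult: "x \<in> \<O> \<Longrightarrow> y \<in> \<O> \<Longrightarrow> x * y \<in> \<O>"
proof -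
  assume "x \<in> \<O>" "y \<in> \<O>"
  from integral_stable_span[OF this] obtain N v i where *: "i < N" "v i \<noteq> 0"
    "\<And>i. i < N \<Longrightarrow> x * v i \<in> poly_span N v" "\<And>i. i < N \<Longrightarrow> y * v i \<in> poly_span N v" by metis
  show ?thesis
    by (rule integral_if_stable_span[of i N v, OF *(1,2)]) (auto simp: mult.assoc intro!: poly_span_mult[OF *(3)] *)
qed

sublocale \<O>: subring_set \<O>
proof
  show "1 \<in> \<O>" using h_integral[of 1] by simp
  show "- x \<in> \<O>" if "x \<in> \<O>" for x
    using integral_mult[OF h_integral[of "- 1"] that] by (simp add: h_uminus)
qed (auto intro: integral_add integral_mult)

text \<open>\<open>F_q[t]\<close> is integrally closed, by the rational root argument: for a reduced
  fraction \<open>a / b\<close>, clearing denominators in the integral equation shows that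
  \<open>b\<close> divides \<open>a ^ n\<close>, so \<open>b\<close> is a unit.\<close>

lemma base_field_integral:
  assumes "x \<in> \<O>" "x \<in> base_field emb"
  obtains a where "x = h a"
proof -
  obtain y where y: "x = emb y" using assms(2) by (auto simp: base_field_def)
  obtain a0 b0 where ab0: "y = Fract a0 b0" "b0 \<noteq> 0" by (cases y) auto
  obtain u v d where d: "u * a0 + v * b0 = d" "d dvd a0" "d dvd b0" using poly_bezout[OF ab0(2)] .
  obtain a b where ab: "a0 = d * a" "b0 = d * b" using d(2,3) unfolding dvd_def by blast
  have "d \<noteq> 0" "b \<noteq> 0" using ab ab0 by auto
  have "d * (u * a + v * b) = d * 1" using d(1) by (simp add: ab algebra_simps)
  then have uv: "u * a + v * b = 1" using \<open>d \<noteq> 0\<close> by (metis mult_left_cancel)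
  have "y * to_fract b0 = to_fract a0" using ab0 by (simp add: to_fract_def eq_fract)
  then have "x * h b0 = h a0" by (metis y emb_mult poly_emb_def)
  then have xb: "x * h b = h a" using \<open>d \<noteq> 0\<close> by (simp add: ab h_mult)
  obtain n c where c: "x ^ n + (\<Sum>i<n. h (c i) * x ^ i) = 0"
    using assms(1) unfolding ring_of_integers_def by blast
  \<comment> \<open>Because \<open>i < n\<close>, at least one of the \<open>n\<close> factors
    \<open>h b\<close> is left over, so every term except the leading one becomes divisible by
    \<open>b\<close>.\<close>
  have term_eq: "h b ^ n * (h (c i) * x ^ i) = h (b * (c i * a ^ i * b ^ (n - i - 1)))" if "i < n" for i
  proof -
    have "h b ^ n = h b ^ i * h b ^ Suc (n - i - 1)"
      using that by (subst power_add[symmetric]) simp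
    then have "h b ^ n * (h (c i) * x ^ i) = (x * h b) ^ i * (h b * h (c i) * h b ^ (n - i - 1))"
      by (simp add: power_mult_distrib mult_ac)
    then show ?thesis by (simp add: xb h_mult h.hom_power mult_ac)
  qed
  have "0 = h b ^ n * (x ^ n + (\<Sum>i<n. h (c i) * x ^ i))" by (simp add: c)
  also have "\<dots> = (x * h b) ^ n + (\<Sum>i<n. h b ^ n * (h (c i) * x ^ i))"
    by (simp add: distrib_left power_mult_distrib sum_distrib_left mult.commute)
  also have "\<dots> = h (a ^ n + b * (\<Sum>i<n. c i * a ^ i * b ^ (n - i - 1)))"
    by (simp add: xb term_eq h_add h.hom_power h.hom_sum sum_distrib_left)
  finally have "a ^ n + b * (\<Sum>i<n. c i * a ^ i * b ^ (n - i - 1)) = 0" by (metis h_eq_0_iff)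
  then have "a ^ n = b * (- (\<Sum>i<n. c i * a ^ i * b ^ (n - i - 1)))"
    by (simp add: eq_neg_iff_add_eq_0)
  then have "b dvd a ^ n" unfolding dvd_def by blast
  \<comment> \<open>As \<open>a\<close> and \<open>b\<close> are coprime, the factors
    \<open>a\<close> can be removed one by one.\<close>
  then have "b dvd 1"
  proof (induction n)
    case (Suc n)
    have "a ^ n = (u * a + v * b) * a ^ n" by (simp add: uv)
    also have "\<dots> = u * a ^ Suc n + b * (v * a ^ n)" by (simp add: algebra_simps)
    finally have "b dvd a ^ n" using Suc.prems by (metis dvd_add dvd_mult dvd_triv_left)
    then show ?case by (rule Suc.IH)
  qed simp
  then obtain e where e: "1 = b * e" unfolding dvd_def by blast
  have "x = x * h (b * e)" by (simp add: e[symmetric])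
  also have "\<dots> = h (a * e)" by (simp add: h_mult xb[symmetric] mult.assoc)
  finally show ?thesis by (rule that)
qed

end

section \<open>Independence of characters and the trace\<close>

context
  fixes f :: "'a::field \<Rightarrow> 'b::field"
  assumes f: "Defs.field_hom f"
begin

lemma field_hom_1: "f 1 = 1" and field_hom_add: "f (x + y) = f x + f y"
  and field_hom_mult: "f (x * y) = f x * f y"
  using f by (auto simp: Defs.field_hom_def)

lemma field_hom_0: "f 0 = 0"
  using field_hom_add[of 0 0] by (metis add.right_neutral add_left_cancel)

lemma field_hom_uminus: "f (- x) = - f x"
  using field_hom_add[of x "- x"] by (simp add: field_hom_0 eq_neg_iff_add_eq_0 add.commute)

lemma field_hom_diff: "f (x - y) = f x - f y"
  using field_hom_add[of x "- y"] by (simp add: field_hom_uminus)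

lemma field_hom_sum: "f (sum g I) = (\<Sum>i\<in>I. f (g i))"
  by (induction I rule: infinite_finite_induct) (auto simp: field_hom_0 field_hom_add)

lemma field_hom_power: "f (x ^ n) = f x ^ n"
  by (induction n) (auto simp: field_hom_1 field_hom_mult)

end

text \<open>Dedekind's independence of characters, by induction on the number of
  homomorphisms.\<close>

lemma field_hom_independent:
  fixes s :: "'i \<Rightarrow> 'a::field \<Rightarrow> 'b::field"
  assumes "finite I" "inj_on s I" "\<And>i. i \<in> I \<Longrightarrow> Defs.field_hom (s i)"
    and "\<And>x. (\<Sum>i\<in>I. c i * s i x) = 0"
  shows "\<forall>i\<in>I. c i = 0"
  using assms
proof (induction I arbitrary: c rule: finite_induct)
  case (insert k I)
  have hom: "Defs.field_hom (s i)" if "i \<in> insert k I" for i using insert.prems(2) that by blast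
  \<comment> \<open>Subtracting \<open>s k y\<close> times the relation at \<open>x\<close> from the
    relation at \<open>y * x\<close> eliminates the term of \<open>k\<close>.\<close>
  have zero: "(\<Sum>i\<in>I. c i * (s i y - s k y) * s i x) = 0" for x y
  proof -
    have "0 = (\<Sum>i\<in>insert k I. c i * s i (y * x)) - s k y * (\<Sum>i\<in>insert k I. c i * s i x)"
      using insert.prems(3) by simp
    also have "\<dots> = (\<Sum>i\<in>insert k I. c i * (s i y - s k y) * s i x)"
      by (simp only: sum_distrib_left sum_subtractf[symmetric])
        (intro sum.cong refl, simp add: field_hom_mult[OF hom] algebra_simps)
    finally show ?thesis using insert.hyps by simp
  qed
  have I0: "c i = 0" if i: "i \<in> I" for i
  proof -
    have "s i \<noteq> s k" using insert.prems(1) insert.hyps(2) i by (metis inj_onD insert_iff)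
    then obtain y where y: "s i y \<noteq> s k y" by blast
    have "\<forall>i\<in>I. c i * (s i y - s k y) = 0"
      by (rule insert.IH) (use insert.prems zero in \<open>auto simp: inj_on_insert\<close>)
    then show ?thesis using i y by (metis eq_iff_diff_eq_0 mult_eq_0_iff)
  qed
  moreover have "c k = 0"
    using insert.prems(3)[of 1] insert.hyps I0 by (simp add: field_hom_1[OF hom])
  ultimately show ?case by blast
qed simp

section \<open>Invariance of the degree\<close>

context function_field_ext
begin

lemma is_basis_independentD:
  assumes "is_basis emb n b" "\<And>i. i < n \<Longrightarrow> c i \<in> base_field emb" "(\<Sum>i<n. c i * b i) = 0" "i < n"
  shows "c i = 0"
  using assms unfolding is_basis_def by blast

lemma is_basis_inj_on:
  assumes "is_basis emb n b"
  shows "inj_on b {..<n}"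
proof (rule inj_onI, rule ccontr)
  fix i j assume ij: "i \<in> {..<n}" "j \<in> {..<n}" "b i = b j" "i \<noteq> j"
  define c where "c k = emb (if k = i then 1 else if k = j then - 1 else 0)" for k
  have "(\<Sum>k<n. c k * b k) = (\<Sum>k\<in>{i, j}. c k * b k)"
    using ij by (intro sum.mono_neutral_right) (auto simp: c_def emb_0)
  also have "\<dots> = 0" using ij by (simp add: c_def emb_1 emb_uminus)
  finally have "c i = 0"
    using ij(1) by (intro is_basis_independentD[OF assms, of c i]) (auto simp: c_def base_field_def)
  then show False by (simp add: c_def emb_1)
qed

text \<open>Both lengths equal the dimension of \<open>'k\<close> as a vector space over
  \<open>F_q(t)\<close> acting through \<open>emb\<close>. This makes the description in
  \<open>ext_degree\<close> definite.\<close>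

lemma is_basis_unique:
  assumes "is_basis emb n b" "is_basis emb m c"
  shows "n = m"
proof -
  interpret vs: vector_space "\<lambda>a x. emb a * x"
    by standard (auto simp: emb_add emb_mult emb_1 algebra_simps)
  have dim: "vs.dim (UNIV :: 'k set) = n" if b: "is_basis emb n b" for n b
  proof -
    note inj = is_basis_inj_on[OF b]
    have "\<not> vs.dependent (b ` {..<n})"
    proof
      assume "vs.dependent (b ` {..<n})"
      then obtain u where u: "\<exists>v\<in>b ` {..<n}. u v \<noteq> 0" "(\<Sum>v\<in>b ` {..<n}. emb (u v) * v) = 0"
        using vs.dependent_finite[of "b ` {..<n}"] by auto
      have "(\<Sum>i<n. emb (u (b i)) * b i) = 0" using u(2) inj by (simp add: sum.reindex)
      then have "emb (u (b i)) = 0" if "i < n" for i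
        using that by (intro is_basis_independentD[OF b, of "\<lambda>i. emb (u (b i))" i]) (auto simp: base_field_def)
      then show False using u(1) by (auto simp: emb_eq_0_iff)
    qed
    moreover have "x \<in> vs.span (b ` {..<n})" for x
    proof -
      obtain c where c: "\<And>i. i < n \<Longrightarrow> c i \<in> range emb" "x = (\<Sum>i<n. c i * b i)"
        using b unfolding is_basis_def base_field_def by blast
      have "c i * b i \<in> vs.span (b ` {..<n})" if i: "i \<in> {..<n}" for i
      proof -
        obtain e where "c i = emb e" using c(1)[of i] i by auto
        then show ?thesis using i vs.span_scale[OF vs.span_base[of "b i" "b ` {..<n}"], of e] by simp
      qed
      then show ?thesis unfolding c(2) by (rule vs.span_sum)
    qed
    then have "vs.span (b ` {..<n}) = vs.span UNIV" by (metis UNIV_eq_I vs.span_UNIV)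
    ultimately have "vs.dim UNIV = card (b ` {..<n})" using vs.dim_eq_card by blast
    then show ?thesis using inj by (simp add: card_image)
  qed
  show ?thesis using dim[OF assms(1)] dim[OF assms(2)] by simp
qed

end

section \<open>The Galois group and the trace as a sum of conjugates\<close>

locale galois_function_field = function_field_ext emb
  for emb :: "'f::{finite,field} poly fract \<Rightarrow> 'k::field" +
  assumes galois: "galois_ext emb"
begin

abbreviation "n \<equiv> ext_degree emb"
abbreviation "b \<equiv> ext_basis emb"
abbreviation "G \<equiv> ext_auts emb"

lemma is_basis_ext_basis: "is_basis emb n b"
proof -
  obtain m c where mc: "is_basis emb m c" using galois by (auto simp: galois_ext_def finite_ext_def)
  then have "\<exists>c. is_basis emb n c"
    unfolding ext_degree_def by (rule_tac theI[of _ m]) (auto dest: is_basis_unique)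
  then show ?thesis unfolding ext_basis_def by (rule someI_ex)
qed

lemma coord_in_base_field: "i < n \<Longrightarrow> coord emb y i \<in> base_field emb"
  and sum_coord: "(\<Sum>i<n. coord emb y i * b i) = y"
proof -
  have "\<exists>c. (\<forall>i<n. c i \<in> base_field emb) \<and> y = (\<Sum>i<n. c i * b i)"
    using is_basis_ext_basis unfolding is_basis_def by blast
  from someI_ex[OF this] show "i < n \<Longrightarrow> coord emb y i \<in> base_field emb"
    "(\<Sum>i<n. coord emb y i * b i) = y"
    unfolding coord_def by auto
qed

lemma aut_hom: "s \<in> G \<Longrightarrow> Defs.field_hom s" and aut_bij: "s \<in> G \<Longrightarrow> bij s"
  and aut_base: "s \<in> G \<Longrightarrow> x \<in> base_field emb \<Longrightarrow> s x = x"
  by (auto simp: ext_auts_def)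

lemma aut_h: "s \<in> G \<Longrightarrow> s (h a) = h a"
  using aut_base h_in_base_field by blast

lemma aut_integral:
  assumes s: "s \<in> G" and x: "x \<in> \<O>"
  shows "s x \<in> \<O>"
proof -
  obtain m a where a: "x ^ m + (\<Sum>i<m. h (a i) * x ^ i) = 0"
    using x unfolding ring_of_integers_def by blast
  note hom = aut_hom[OF s]
  have "s x ^ m + (\<Sum>i<m. h (a i) * s x ^ i) = s (x ^ m + (\<Sum>i<m. h (a i) * x ^ i))"
    by (simp add: field_hom_add[OF hom] field_hom_mult[OF hom] field_hom_sum[OF hom]
        field_hom_power[OF hom] aut_h[OF s])
  then have "s x ^ m + (\<Sum>i<m. h (a i) * s x ^ i) = 0" by (simp add: a field_hom_0[OF hom])
  then show ?thesis unfolding ring_of_integers_def by blast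
qed

lemma group_auts: "group \<lparr>carrier = G, monoid.mult = (\<circ>), one = id\<rparr>"
proof (rule groupI)
  fix s t assume "s \<in> carrier \<lparr>carrier = G, monoid.mult = (\<circ>), one = id\<rparr>"
    "t \<in> carrier \<lparr>carrier = G, monoid.mult = (\<circ>), one = id\<rparr>"
  then show "s \<otimes>\<^bsub>\<lparr>carrier = G, monoid.mult = (\<circ>), one = id\<rparr>\<^esub> t
      \<in> carrier \<lparr>carrier = G, monoid.mult = (\<circ>), one = id\<rparr>"
    by (auto simp: ext_auts_def Defs.field_hom_def intro: bij_comp)
next
  fix s assume "s \<in> carrier \<lparr>carrier = G, monoid.mult = (\<circ>), one = id\<rparr>"
  then have s: "s \<in> G" by simp
  note bij = aut_bij[OF s] and hom = aut_hom[OF s]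
  define t where "t = inv_into UNIV s"
  have inv: "s (t x) = x" "t (s x) = x" for x
    using bij by (simp_all add: t_def bij_def surj_f_inv_f)
  have "t (x + y) = t x + t y" "t (x * y) = t x * t y" for x y
    by (metis field_hom_add[OF hom] inv) (metis field_hom_mult[OF hom] inv)
  moreover have "t x = x" if "x \<in> base_field emb" for x by (metis aut_base[OF s that] inv(2))
  moreover have "t 1 = 1" by (metis field_hom_1[OF hom] inv(2))
  ultimately have "t \<in> G"
    using bij by (simp add: ext_auts_def Defs.field_hom_def t_def bij_imp_bij_inv)
  moreover have "t \<circ> s = id" using inv(2) by auto
  ultimately show "\<exists>u\<in>carrier \<lparr>carrier = G, monoid.mult = (\<circ>), one = id\<rparr>.
      u \<otimes>\<^bsub>\<lparr>carrier = G, monoid.mult = (\<circ>), one = id\<rparr>\<^esub> s = \<one>\<^bsub>\<lparr>carrier = G, monoid.mult = (\<circ>), one = id\<rparr>\<^esub>"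
    by auto
qed (auto simp: ext_auts_def Defs.field_hom_def)

lemma id_in_auts: "id \<in> G"
  by (auto simp: ext_auts_def Defs.field_hom_def)

lemma card_auts: "card G = n" and finite_auts: "finite G"
  using galois by (auto simp: galois_ext_def)

text \<open>Lagrange's theorem in the Galois group, whose order is the degree.\<close>

lemma aut_funpow_degree:
  assumes "s \<in> G"
  shows "(s ^^ n) x = x"
proof -
  interpret group "\<lparr>carrier = G, monoid.mult = (\<circ>), one = id\<rparr>" by (rule group_auts)
  have "s [^]\<^bsub>\<lparr>carrier = G, monoid.mult = (\<circ>), one = id\<rparr>\<^esub> (k::nat) = s ^^ k" for k
    by (induction k) (auto simp: funpow_Suc_right simp del: funpow.simps(2))
  then have "s ^^ n = id"
    using pow_order_eq_1[of s] assms card_auts by (simp add: order_def)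
  then show ?thesis by simp
qed

text \<open>An enumeration of the Galois group by the indices of a basis; since the order equals the
  degree, the matrix of conjugates is square.\<close>

definition aut :: "nat \<Rightarrow> 'k \<Rightarrow> 'k" where
  "aut = (SOME f. bij_betw f {..<n} G)"

lemma bij_betw_aut: "bij_betw aut {..<n} G"
proof -
  have "\<exists>f. bij_betw f {..<n} G"
    using ex_bij_betw_nat_finite[OF finite_auts] by (simp add: card_auts atLeast0LessThan)
  then show ?thesis unfolding aut_def by (rule someI_ex)
qed

lemma aut_in_auts: "j < n \<Longrightarrow> aut j \<in> G"
  using bij_betw_aut by (auto simp: bij_betw_def)

lemmas aut_field_hom = aut_hom[OF aut_in_auts]

lemma aut_id_index: obtains j where "j < n" "aut j = id"
  using bij_betw_aut id_in_auts by (metis bij_betw_def imageE lessThan_iff)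

text \<open>A kernel vector would be a linear relation between the automorphisms on the basis, hence
  everywhere, against their independence.\<close>

lemma det_aut_basis_nonzero: "det_n n (\<lambda>i j. aut j (b i)) \<noteq> 0"
proof
  assume "det_n n (\<lambda>i j. aut j (b i)) = 0"
  then obtain v where v: "\<exists>j<n. v j \<noteq> 0" "\<And>i. i < n \<Longrightarrow> (\<Sum>j<n. aut j (b i) * v j) = 0"
    by (rule det_n_eq_0_kernel) blast
  have "(\<Sum>j<n. v j * aut j x) = 0" for x
  proof -
    have "aut j x = (\<Sum>i<n. coord emb x i * aut j (b i))" if "j < n" for j
    proof -
      have "aut j x = aut j (\<Sum>i<n. coord emb x i * b i)" by (simp add: sum_coord)
      also have "\<dots> = (\<Sum>i<n. coord emb x i * aut j (b i))"
        using that by (auto simp: field_hom_sum[OF aut_field_hom] field_hom_mult[OF aut_field_hom]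
            aut_base[OF aut_in_auts] coord_in_base_field intro!: sum.cong)
      finally show ?thesis .
    qed
    then have "(\<Sum>j<n. v j * aut j x) = (\<Sum>j<n. \<Sum>i<n. coord emb x i * (aut j (b i) * v j))"
      by (intro sum.cong refl) (simp add: sum_distrib_left mult_ac)
    also have "\<dots> = (\<Sum>i<n. coord emb x i * (\<Sum>j<n. aut j (b i) * v j))"
      by (subst sum.swap) (simp add: sum_distrib_left)
    finally show ?thesis using v(2) by simp
  qed
  then have "\<forall>j\<in>{..<n}. v j = 0"
    using bij_betw_aut by (intro field_hom_independent[of _ aut]) (auto simp: bij_betw_def aut_field_hom)
  then show False using v(1) by auto
qed

text \<open>The matrix \<open>m\<close> of multiplication by \<open>x\<close> satisfies
  \<open>m B = B diag\<close>, where \<open>diag\<close> is diagonal with entries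
  \<open>aut j x\<close>. As \<open>B\<close> is invertible, \<open>m\<close> and
  \<open>diag\<close> have the same trace.\<close>

lemma ext_trace_eq_sum_aut: "ext_trace emb x = (\<Sum>j<n. aut j x)"
proof -
  define B where "B i j = aut j (b i)" for i j
  define m where "m i k = coord emb (x * b i) k" for i k
  define D where "D = det_n n B"
  have D: "D \<noteq> 0" using det_aut_basis_nonzero by (simp add: D_def B_def[abs_def])
  have eig: "(\<Sum>k<n. m i k * B k j) = aut j x * B i j" if "i < n" "j < n" for i j
  proof -
    have "aut j x * B i j = aut j (\<Sum>k<n. m i k * b k)"
      using that by (simp add: m_def sum_coord B_def field_hom_mult[OF aut_field_hom])
    also have "\<dots> = (\<Sum>k<n. m i k * B k j)"
      using that by (auto simp: field_hom_sum[OF aut_field_hom] field_hom_mult[OF aut_field_hom] B_def m_def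
          aut_base[OF aut_in_auts] coord_in_base_field intro!: sum.cong)
    finally show ?thesis by simp
  qed
  \<comment> \<open>Diagonal entries of \<open>D m = m B adj = B diag adj\<close>; the factor
    \<open>D\<close> is cancelled at the very end.\<close>
  have diag: "D * m i i = (\<Sum>j<n. aut j x * (adj_n n B j i * B i j))" if i: "i < n" for i
  proof -
    have "D * m i i = (\<Sum>k<n. m i k * (\<Sum>j<n. B k j * adj_n n B j i))"
      using i by (simp add: mat_mult_adj_n D_def if_distrib[of "\<lambda>x. _ * x"] mult.commute cong: if_cong)
    also have "\<dots> = (\<Sum>j<n. (\<Sum>k<n. m i k * B k j) * adj_n n B j i)"
      by (simp only: sum_distrib_left sum_distrib_right mult.assoc) (rule sum.swap)
    also have "\<dots> = (\<Sum>j<n. aut j x * (adj_n n B j i * B i j))"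
      using i by (intro sum.cong) (auto simp: eig)
    finally show ?thesis .
  qed
  have "D * ext_trace emb x = (\<Sum>i<n. D * m i i)"
    by (simp add: ext_trace_def m_def sum_distrib_left)
  also have "\<dots> = (\<Sum>i<n. \<Sum>j<n. aut j x * (adj_n n B j i * B i j))" by (simp add: diag)
  also have "\<dots> = (\<Sum>j<n. aut j x * (\<Sum>i<n. adj_n n B j i * B i j))"
    by (simp only: sum_distrib_left) (rule sum.swap)
  also have "\<dots> = (\<Sum>j<n. aut j x * D)"
    by (intro sum.cong refl arg_cong2[where f = times]) (simp add: adj_n_mult_mat D_def)
  also have "\<dots> = D * (\<Sum>j<n. aut j x)"
    by (simp add: sum_distrib_left mult.commute)
  finally show ?thesis using D by simp
qed

definition poly_trace :: "'k \<Rightarrow> 'f poly" where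
  "poly_trace x = (SOME a. h a = ext_trace emb x)"

text \<open>The trace is integral as a sum of conjugates and lies in the base field by its
  definition through coordinates, so it is a polynomial.\<close>

lemma h_poly_trace:
  assumes "x \<in> \<O>"
  shows "h (poly_trace x) = ext_trace emb x"
proof -
  have "aut j x \<in> \<O>" if "j \<in> {..<n}" for j
    using aut_integral[OF aut_in_auts assms] that by simp
  then have "ext_trace emb x \<in> \<O>"
    unfolding ext_trace_eq_sum_aut by (rule \<O>.sum_closed)
  moreover have "ext_trace emb x \<in> base_field emb"
  proof -
    have "\<forall>i. \<exists>e. i < n \<longrightarrow> coord emb (x * b i) i = emb e"
      using coord_in_base_field by (auto simp: base_field_def)
    then obtain e where "\<And>i. i < n \<Longrightarrow> coord emb (x * b i) i = emb (e i)" by metis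
    then have "ext_trace emb x = emb (\<Sum>i<n. e i)"
      by (simp add: ext_trace_def field_hom_sum[OF field_hom_emb])
    then show ?thesis by (simp add: base_field_def)
  qed
  ultimately obtain a where "ext_trace emb x = h a" by (rule base_field_integral)
  then have "\<exists>a. h a = ext_trace emb x" by metis
  then show ?thesis unfolding poly_trace_def by (rule someI_ex)
qed

lemma h_poly_trace_sum: "x \<in> \<O> \<Longrightarrow> h (poly_trace x) = (\<Sum>j<n. aut j x)"
  by (simp add: h_poly_trace ext_trace_eq_sum_aut)

end

section \<open>A family of integers whose discriminant is prime to the polynomial\<close>

lemma subring_set_UNIV: "subring_set UNIV"
  by standard auto

lemma det_n_cong:
  assumes "\<And>i j. i < n \<Longrightarrow> j < n \<Longrightarrow> M i j = N i j"
  shows "det_n n M = det_n n N"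
proof -
  have "mat_n n M = mat_n n N" by (rule eq_matI) (auto simp: mat_n_def assms)
  then show ?thesis by (metis det_mat_n)
qed

lemma bezout_mult:
  fixes d p q :: "'a::comm_ring_1"
  assumes "u1 * d + v1 * p = 1" "u2 * d + v2 * q = 1"
  obtains u v where "u * d + v * (p * q) = 1"
proof (rule that)
  have "(u1 + v1 * p * u2) * d + v1 * v2 * (p * q) = u1 * d + v1 * p * (u2 * d + v2 * q)"
    by (simp add: algebra_simps)
  then show "(u1 + v1 * p * u2) * d + v1 * v2 * (p * q) = 1" using assms by simp
qed

context galois_function_field
begin

definition disc :: "(nat \<Rightarrow> 'k) \<Rightarrow> 'f poly" where
  "disc x = det_n n (\<lambda>i j. poly_trace (x i * x j))"

lemma h_det_n: "h (det_n m M) = det_n m (\<lambda>i j. h (M i j))"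
  by (rule det_n_hom) (auto simp: h_add h_mult h_uminus)

lemma h_disc:
  assumes "\<And>i. i < n \<Longrightarrow> x i \<in> \<O>"
  shows "h (disc x) = det_n n (\<lambda>i j. ext_trace emb (x i * x j))"
  unfolding disc_def h_det_n
  by (rule det_n_cong) (simp add: h_poly_trace integral_mult assms)

text \<open>The trace form is the matrix of conjugates times its transpose.\<close>

lemma h_disc_eq_square:
  assumes "\<And>i. i < n \<Longrightarrow> x i \<in> \<O>"
  shows "h (disc x) = (det_n n (\<lambda>i j. aut j (x i)))\<^sup>2"
proof -
  have "h (disc x) = det_n n (\<lambda>i j. ext_trace emb (x i * x j))"
    using assms by (rule h_disc)
  also have "\<dots> = det_n n (\<lambda>i j. \<Sum>k<n. aut k (x i) * aut k (x j))"
    by (rule det_n_cong) (simp add: ext_trace_eq_sum_aut field_hom_mult[OF aut_field_hom])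
  finally show ?thesis by (simp add: det_n_mult_transpose)
qed

lemma poly_trace_add: "x \<in> \<O> \<Longrightarrow> y \<in> \<O> \<Longrightarrow> poly_trace (x + y) = poly_trace x + poly_trace y"
  by (subst h_eq_iff[symmetric])
    (simp add: h_add h_poly_trace_sum integral_add field_hom_add[OF aut_field_hom] sum.distrib)

lemma poly_trace_scale: "x \<in> \<O> \<Longrightarrow> poly_trace (h a * x) = a * poly_trace x"
  by (subst h_eq_iff[symmetric])
    (simp add: h_mult h_poly_trace_sum integral_mult field_hom_mult[OF aut_field_hom]
      aut_h[OF aut_in_auts] sum_distrib_left)

lemma poly_trace_combination:
  assumes "x \<in> \<O>" "x' \<in> \<O>" "y \<in> \<O>" "y' \<in> \<O>"
  shows "poly_trace ((h a * x + h c * y) * (h a * x' + h c * y')) =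
    a * a * poly_trace (x * x') + a * c * (poly_trace (x * y') + poly_trace (y * x')) +
    c * c * poly_trace (y * y')"
proof -
  have "(h a * x + h c * y) * (h a * x' + h c * y') =
      h (a * a) * (x * x') + h (a * c) * (x * y' + y * x') + h (c * c) * (y * y')"
    by (simp add: h_mult algebra_simps)
  then show ?thesis
    using assms by (simp add: poly_trace_add poly_trace_scale integral_mult integral_add)
qed

text \<open>Modulo \<open>q\<close> the combined family is the family \<open>x\<close>, so the trace
  forms agree entrywise and the determinants follow. This is the gluing step for the Chinese
  remainder argument.\<close>

lemma disc_combination_dvd:
  assumes x: "\<And>i. i < n \<Longrightarrow> x i \<in> \<O>" and y: "\<And>i. i < n \<Longrightarrow> y i \<in> \<O>"
    and "q dvd c" "q dvd a - 1"
  shows "q dvd disc (\<lambda>i. h a * x i + h c * y i) - disc x"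
  unfolding disc_def
proof (rule det_n_dvd_diff)
  fix i j assume ij: "i < n" "j < n"
  have "poly_trace ((h a * x i + h c * y i) * (h a * x j + h c * y j)) - poly_trace (x i * x j) =
      (a - 1) * ((a + 1) * poly_trace (x i * x j)) +
      c * (a * (poly_trace (x i * y j) + poly_trace (y i * x j)) + c * poly_trace (y i * y j))"
    unfolding poly_trace_combination[OF x[OF ij(1)] x[OF ij(2)] y[OF ij(1)] y[OF ij(2)]]
    by (simp add: algebra_simps)
  then show "q dvd poly_trace ((h a * x i + h c * y i) * (h a * x j + h c * y j)) - poly_trace (x i * x j)"
    using assms(3,4) by (simp add: dvd_add dvd_mult2)
qed

text \<open>If \<open>p\<close> divided the discriminants of all integral families, it would divide
  the whole ideal they generate.\<close>

lemma integral_family_not_dvd_disc: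
  assumes "rel_prime_ideal (discriminant_ideal emb) g" "irreducible p" "p dvd g"
  obtains x where "\<And>i. i < n \<Longrightarrow> x i \<in> \<O>" "\<not> p dvd disc x"
proof -
  interpret P: subring_set "UNIV :: 'f poly set" by (rule subring_set_UNIV)
  interpret R: cring "subring_struct (UNIV :: 'f poly set)" by (rule P.cring_subring_struct)
  let ?S = "{d. \<exists>x. (\<forall>i<n. x i \<in> \<O>) \<and> h d = det_n n (\<lambda>i j. ext_trace emb (x i * x j))}"
  have "\<exists>d\<in>?S. \<not> p dvd d"
  proof (rule ccontr)
    assume "\<not> ?thesis"
    then have "?S \<subseteq> {p * z |z. z \<in> UNIV}" unfolding dvd_def by blast
    then have "?S \<subseteq> Idl\<^bsub>subring_struct UNIV\<^esub> {p}" by (simp only: P.principal_ideal_eq[OF UNIV_I])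
    then have "Idl\<^bsub>subring_struct UNIV\<^esub> ?S \<subseteq> Idl\<^bsub>subring_struct UNIV\<^esub> {p}"
      by (intro R.genideal_minimal R.genideal_ideal) (auto simp: subring_struct_def)
    then have "discriminant_ideal emb \<subseteq> {p * z |z. z \<in> UNIV}"
      unfolding discriminant_ideal_def poly_ring_def by (simp only: P.principal_ideal_eq[OF UNIV_I])
    then have "\<forall>d\<in>discriminant_ideal emb. p dvd d" by (auto simp: dvd_def)
    then show False using assms unfolding rel_prime_ideal_def by blast
  qed
  then obtain d x where "\<not> p dvd d" "\<forall>i<n. x i \<in> \<O>"
    "h d = det_n n (\<lambda>i j. ext_trace emb (x i * x j))" by blast
  moreover from this have "d = disc x" by (metis h_disc h_eq_iff)
  ultimately show ?thesis using that by blast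
qed

text \<open>Induction on the degree of \<open>q\<close>: split off an irreducible factor
  \<open>p\<close>, take a family for the cofactor \<open>r\<close>, and change it modulo
  \<open>p\<close> where necessary.\<close>

lemma integral_family_disc_coprime:
  assumes rp: "rel_prime_ideal (discriminant_ideal emb) g" and "q \<noteq> 0" "q dvd g"
  obtains x u v where "\<And>i. i < n \<Longrightarrow> x i \<in> \<O>" "u * disc x + v * q = 1"
proof -
  have "\<exists>x u v. (\<forall>i<n. x i \<in> \<O>) \<and> u * disc x + v * q = 1"
    using assms(2,3)
  proof (induction "degree q" arbitrary: q rule: less_induct)
    case less
    show ?case
    proof (cases "q dvd 1")
      case True
      then obtain v where "v * q = 1" unfolding dvd_def by (metis mult.commute)
      \<comment> \<open>For a unit \<open>q\<close> the zero family serves, with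
        \<open>u = 0\<close>.\<close>
      then show ?thesis by (intro exI[of _ "\<lambda>_. 0"] exI[of _ 0] exI[of _ v]) auto
    next
      case False
      then obtain p where p: "irreducible p" "p dvd q" using poly_irreducible_factor less.prems(1) by blast
      then obtain r where r: "q = p * r" unfolding dvd_def by blast
      have nz: "p \<noteq> 0" "r \<noteq> 0" using r less.prems(1) by auto
      have "degree p \<noteq> 0" using p(1) nz(1) is_unit_iff_degree[of p] by (auto simp: irreducible_def)
      then have "degree r < degree q" using r nz by (simp add: degree_mult_eq)
      moreover have "r dvd g" using r less.prems(2) by (metis dvd_mult_right)
      ultimately obtain x u v where x: "\<And>i. i < n \<Longrightarrow> x i \<in> \<O>" "u * disc x + v * r = 1"
        using less.hyps[of r] nz(2) by blast
      show ?thesis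
      proof (cases "p dvd disc x")
        case False
        \<comment> \<open>Repeated factors fall under this case: if \<open>p\<close> divides
          \<open>r\<close>, it cannot divide \<open>disc x\<close>, which is coprime to
          \<open>r\<close>.\<close>
        from irreducible_not_dvd_bezout[OF p(1) this] obtain u1 v1 where "u1 * disc x + v1 * p = 1" .
        from bezout_mult[OF this x(2)] show ?thesis using x(1) r by metis
      next
        case True
        then obtain e where e: "disc x = p * e" unfolding dvd_def by blast
        obtain y where y: "\<And>i. i < n \<Longrightarrow> y i \<in> \<O>" "\<not> p dvd disc y"
          using integral_family_not_dvd_disc[OF rp p(1)] p(2) less.prems(2) dvd_trans by blast
        \<comment> \<open>Chinese remainder weights read off from the Bezout identity:
          \<open>?a\<close> is 1 modulo \<open>r\<close> and 0 modulo \<open>p\<close>, and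
          \<open>?c\<close> is 0 modulo \<open>r\<close> and 1 modulo \<open>p\<close>. Hence
          \<open>z\<close> agrees with \<open>x\<close> modulo \<open>r\<close> and with
          \<open>y\<close> modulo \<open>p\<close>.\<close>
        let ?a = "u * (p * e)" and ?c = "v * r"
        have ac: "?a + ?c = 1" using x(2) e by simp
        then have ac': "?a - 1 = - ?c" "?c - 1 = - ?a" by (simp_all add: algebra_simps eq_neg_iff_add_eq_0)
        define z where "z i = h ?a * x i + h ?c * y i" for i
        have zO: "z i \<in> \<O>" if "i < n" for i
          using x(1)[OF that] y(1)[OF that] by (auto simp: z_def intro!: integral_add integral_mult)
        have "r dvd disc z - disc x"
          unfolding z_def by (rule disc_combination_dvd[of x y, OF x(1) y(1)]) (simp_all only: ac' dvd_minus_iff dvd_triv_right)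
        then obtain k where k: "disc z - disc x = r * k" unfolding dvd_def by blast
        have "u * disc z + (v - u * k) * r = u * disc x + u * (disc z - disc x) - u * k * r + v * r"
          by (simp add: algebra_simps)
        also have "\<dots> = 1" using x(2) by (simp add: k mult_ac)
        finally have rz: "u * disc z + (v - u * k) * r = 1" .
        have "z = (\<lambda>i. h ?c * y i + h ?a * x i)" by (auto simp: z_def add.commute)
        then have "p dvd disc z - disc y"
          using disc_combination_dvd[of y x p ?a ?c, OF y(1) x(1)] by (simp only: ac') simp
        then have "\<not> p dvd disc z" using y(2) dvd_diff[of p "disc z" "disc z - disc y"] by auto
        from irreducible_not_dvd_bezout[OF p(1) this] obtain u1 v1 where "u1 * disc z + v1 * p = 1" .
        from bezout_mult[OF this rz] show ?thesis using zO r by metis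
      qed
    qed
  qed
  then show ?thesis using that by blast
qed

end

section \<open>The quotient of the ring of integers\<close>

lemma infinite_UNIV_poly: "infinite (UNIV :: 'a::comm_ring_1 poly set)"
proof -
  have "inj (\<lambda>k. Polynomial.monom (1::'a) k)"
    by (auto simp: inj_on_def Polynomial.monom_eq_iff')
  then show ?thesis using infinite_UNIV_nat finite_subset[OF subset_UNIV] by (metis finite_imageD)
qed

context subring_set
begin

lemma cong_mod_power:
  assumes "x \<in> A" "y \<in> A" "cong_mod \<alpha> x y"
  shows "cong_mod \<alpha> (x ^ k) (y ^ k)"
proof (induction k)
  case (Suc k)
  have "cong_mod \<alpha> (x * x ^ k) (x * y ^ k)"
    using Suc assms(1) by (rule_tac cong_mod_mult_left)
  also have "cong_mod \<alpha> (x * y ^ k) (y * y ^ k)"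
    using assms by (intro cong_mod_mult_right power_closed)
  finally show ?case by simp
qed simp

lemma cong_mod_sum_0: "(\<And>i. i \<in> I \<Longrightarrow> cong_mod \<alpha> (f i) 0) \<Longrightarrow> cong_mod \<alpha> (sum f I) 0"
  using cong_mod_sum[of I \<alpha> f "\<lambda>_. 0"] by simp

end

section \<open>A basis of the integers modulo \<open>g\<close>\<close>

locale disc_coprime = galois_function_field emb
  for emb :: "'f::{finite,field} poly fract \<Rightarrow> 'k::field" +
  fixes g u v :: "'f poly" and x :: "nat \<Rightarrow> 'k"
  assumes x_integral: "\<And>i. i < n \<Longrightarrow> x i \<in> \<O>"
    and disc_bezout: "u * disc x + v * g = 1"
begin

abbreviation cong_g :: "'k \<Rightarrow> 'k \<Rightarrow> bool"  (infix \<open>\<approx>\<close> 50) where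
  "y \<approx> z \<equiv> \<O>.cong_mod (h g) y z"

lemma h_cong_if_dvd: "g dvd a - c \<Longrightarrow> h a \<approx> h c"
  unfolding dvd_def \<O>.cong_mod_def by (metis h_diff h_integral h_mult)

definition conj_mat :: "nat \<Rightarrow> nat \<Rightarrow> 'k" where
  "conj_mat i j = aut j (x i)"

abbreviation "\<delta> \<equiv> det_n n conj_mat"

lemma conj_mat_integral: "i < n \<Longrightarrow> j < n \<Longrightarrow> conj_mat i j \<in> \<O>"
  unfolding conj_mat_def by (rule aut_integral[OF aut_in_auts x_integral])

lemma det_integral: "\<delta> \<in> \<O>"
  by (rule \<O>.det_n_closed[OF conj_mat_integral])

lemma adj_integral: "i < n \<Longrightarrow> j < n \<Longrightarrow> adj_n n conj_mat i j \<in> \<O>"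
  by (rule \<O>.adj_n_closed[OF conj_mat_integral])

lemma det_square: "\<delta> * \<delta> = h (disc x)"
  using h_disc_eq_square[of x] x_integral by (simp add: conj_mat_def[abs_def] power2_eq_square)

text \<open>The square of \<delta> is the discriminant, whose inverse modulo \<open>g\<close> is
  \<open>u\<close>; thus \<open>h u * \<delta>\<close> inverts \<delta> modulo
  \<open>g\<close>.\<close>

lemma disc_unit:
  assumes "y \<in> \<O>"
  shows "h u * (\<delta> * (\<delta> * y)) \<approx> y"
  unfolding \<O>.cong_mod_def
proof (rule bexI)
  have "h u * h (disc x) + h v * h g = 1" using disc_bezout by (metis h_1 h_add h_mult)
  then have "y = (h u * h (disc x) + h v * h g) * y" by simp
  then show "h u * (\<delta> * (\<delta> * y)) - y = h g * (- (h v * y))"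
    using det_square by (simp add: algebra_simps)
  show "- (h v * y) \<in> \<O>" using assms by (intro \<O>.uminus_closed \<O>.mult_closed h_integral)
qed

lemma det_cancel:
  assumes "y \<in> \<O>" "\<delta> * y \<approx> 0"
  shows "y \<approx> 0"
proof -
  have "y \<approx> h u * (\<delta> * (\<delta> * y))" by (rule \<O>.cong_mod_sym[OF disc_unit[OF assms(1)]])
  also have "h u * (\<delta> * (\<delta> * y)) = h u * \<delta> * (\<delta> * y)" by (simp add: mult.assoc)
  also have "h u * \<delta> * (\<delta> * y) \<approx> h u * \<delta> * 0"
    using assms by (intro \<O>.cong_mod_mult_left \<O>.mult_closed h_integral det_integral)
  finally show ?thesis by simp
qed

text \<open>The adjugate turns the system into \<open>\<delta> * w j \<approx> 0\<close>, and
  \<delta> cancels. All comparisons of coefficients of automorphisms modulo \<open>g\<close> rest on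
  this.\<close>

lemma conj_mat_cancel:
  assumes w: "\<And>j. j < n \<Longrightarrow> w j \<in> \<O>" and 0: "\<And>k. k < n \<Longrightarrow> (\<Sum>j<n. conj_mat k j * w j) \<approx> 0"
    and j: "j < n"
  shows "w j \<approx> 0"
proof (rule det_cancel[OF w[OF j]])
  have "adj_n n conj_mat j k * (\<Sum>i<n. conj_mat k i * w i) \<approx> 0" if "k \<in> {..<n}" for k
    using \<O>.cong_mod_mult_left[OF adj_integral[OF j, of k] 0[of k]] that by simp
  then have "(\<Sum>k<n. adj_n n conj_mat j k * (\<Sum>i<n. conj_mat k i * w i)) \<approx> 0"
    by (rule \<O>.cong_mod_sum_0)
  then show "\<delta> * w j \<approx> 0" by (simp add: adj_n_cancels[OF j])
qed

lemma poly_combination_integral: "(\<Sum>i<n. h (r i) * x i) \<in> \<O>"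
  by (rule \<O>.sum_closed) (simp add: integral_mult x_integral)

lemma aut_poly_combination:
  "j < n \<Longrightarrow> aut j (\<Sum>i<n. h (r i) * x i) = (\<Sum>i<n. h (r i) * conj_mat i j)"
  by (simp add: field_hom_sum[OF aut_field_hom] field_hom_mult[OF aut_field_hom]
      aut_h[OF aut_in_auts] conj_mat_def)

text \<open>Automorphisms fix \<open>h g\<close> and preserve the integers, so they preserve the
  ideal generated by \<open>h g\<close>.\<close>

lemma aut_cong:
  assumes "j < n" "y \<approx> z"
  shows "aut j y \<approx> aut j z"
proof -
  from assms(2) obtain t where t: "t \<in> \<O>" "y - z = h g * t" unfolding \<O>.cong_mod_def by blast
  have "aut j y - aut j z = aut j (h g * t)"
    by (simp add: t(2)[symmetric] field_hom_diff[OF aut_field_hom[OF assms(1)]])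
  also have "\<dots> = h g * aut j t"
    by (simp add: field_hom_mult[OF aut_field_hom[OF assms(1)]] aut_h[OF aut_in_auts[OF assms(1)]])
  finally show ?thesis
    unfolding \<O>.cong_mod_def using aut_integral[OF aut_in_auts[OF assms(1)] t(1)] by blast
qed

text \<open>The traces of \<open>y * x k\<close> determine the coordinates of \<open>y\<close>
  through the trace form, up to the factor \<open>disc x\<close>, which is invertible modulo
  \<open>g\<close>.\<close>

lemma poly_combination_exists:
  assumes y: "y \<in> \<O>"
  shows "\<exists>c. y \<approx> (\<Sum>i<n. h (c i) * x i)"
proof -
  define M where "M i j = poly_trace (x i * x j)" for i j
  \<comment> \<open>Cramer's solution for the trace form; it represents \<open>disc x\<close> times
    \<open>y\<close>.\<close>
  define c where "c i = (\<Sum>j<n. adj_n n M i j * poly_trace (y * x j))" for i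
  \<comment> \<open>The conjugates of the difference between that combination and
    \<open>disc x\<close> times \<open>y\<close>; the matrix of conjugates is shown to annihilate
    them.\<close>
  define w where "w j = (\<Sum>i<n. h (c i) * conj_mat i j) - h (disc x) * aut j y" for j
  have wO: "w j \<in> \<O>" if "j < n" for j
    unfolding w_def using that
    by (intro \<O>.diff_closed \<O>.sum_closed \<O>.mult_closed h_integral conj_mat_integral
        aut_integral[OF aut_in_auts y]) auto
  have M: "h (M k i) = (\<Sum>j<n. conj_mat k j * conj_mat i j)" if "k < n" "i < n" for k i
    using that by (simp add: M_def h_poly_trace_sum integral_mult x_integral
        field_hom_mult[OF aut_field_hom] conj_mat_def)
  have t: "h (poly_trace (y * x k)) = (\<Sum>j<n. conj_mat k j * aut j y)" if "k < n" for k
    using that y by (simp add: h_poly_trace_sum integral_mult x_integral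
        field_hom_mult[OF aut_field_hom] conj_mat_def mult.commute)
  have "(\<Sum>j<n. conj_mat k j * w j) = 0" if k: "k < n" for k
  proof -
    have "(\<Sum>j<n. conj_mat k j * (\<Sum>i<n. h (c i) * conj_mat i j)) =
        (\<Sum>j<n. \<Sum>i<n. h (c i) * (conj_mat k j * conj_mat i j))"
      by (simp add: sum_distrib_left mult_ac)
    also have "\<dots> = (\<Sum>i<n. \<Sum>j<n. h (c i) * (conj_mat k j * conj_mat i j))" by (rule sum.swap)
    also have "\<dots> = (\<Sum>i<n. h (c i) * h (M k i))"
      by (intro sum.cong refl) (simp add: M[OF k] sum_distrib_left)
    also have "\<dots> = h (\<Sum>i<n. M k i * c i)" by (simp add: h.hom_sum h_mult mult.commute)
    also have "\<dots> = h (disc x) * h (poly_trace (y * x k))"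
      using adj_n_solves[OF k, of M "\<lambda>j. poly_trace (y * x j)"]
      unfolding c_def by (simp add: h_mult disc_def M_def[abs_def])
    also have "\<dots> = (\<Sum>j<n. conj_mat k j * (h (disc x) * aut j y))"
      by (simp add: t[OF k] sum_distrib_left mult_ac)
    finally show ?thesis by (simp add: w_def right_diff_distrib sum_subtractf)
  qed
  then have w0: "w j \<approx> 0" if "j < n" for j using conj_mat_cancel[of w j] wO that by simp
  \<comment> \<open>The conjugate under the identity is the desired congruence itself.\<close>
  obtain j where j: "j < n" "aut j = id" by (rule aut_id_index)
  have "(\<Sum>i<n. h (c i) * x i) \<approx> h (disc x) * y"
    using w0[OF j(1)] unfolding w_def \<O>.cong_mod_diff_iff by (simp add: conj_mat_def j(2))
  then have "h u * (\<Sum>i<n. h (c i) * x i) \<approx> h u * (h (disc x) * y)"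
    by (rule \<O>.cong_mod_mult_left[OF h_integral])
  also have "h u * (h (disc x) * y) \<approx> y"
    using disc_unit[OF y] by (simp add: det_square[symmetric] mult.assoc)
  finally have "(\<Sum>i<n. h (u * c i) * x i) \<approx> y"
    by (simp add: sum_distrib_left h_mult mult.assoc)
  then show ?thesis using \<O>.cong_mod_sym by (intro exI[of _ "\<lambda>i. u * c i"]) blast
qed

text \<open>Pairing the difference with every \<open>x k\<close> under the trace form gives a linear
  system over \<open>F_q[t]\<close> whose right side is divisible by \<open>g\<close>; the adjugate
  isolates \<open>disc x * (r i - s i)\<close>, and \<open>disc x\<close> is invertible modulo
  \<open>g\<close>.\<close>

lemma poly_combination_unique:
  assumes "(\<Sum>i<n. h (r i) * x i) \<approx> (\<Sum>i<n. h (s i) * x i)" "i < n"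
  shows "g dvd r i - s i"
proof -
  define M where "M i j = poly_trace (x i * x j)" for i j
  obtain z where z: "z \<in> \<O>" "(\<Sum>i<n. h (r i) * x i) - (\<Sum>i<n. h (s i) * x i) = h g * z"
    using assms(1) unfolding \<O>.cong_mod_def by blast
  then have eq: "(\<Sum>i<n. h (r i - s i) * x i) = h g * z"
    by (simp add: h_diff left_diff_distrib sum_subtractf)
  have tr_sum: "poly_trace (\<Sum>i\<in>I. f i) = (\<Sum>i\<in>I. poly_trace (f i))"
    if "\<And>i. i \<in> I \<Longrightarrow> f i \<in> \<O>" "finite I" for f :: "nat \<Rightarrow> 'k" and I
    using that(2,1)
  proof (induction I rule: finite_induct)
    case empty
    show ?case using poly_trace_scale[of 0 0] by simp
  next
    case (insert k I)
    then show ?case by (simp add: poly_trace_add \<O>.sum_closed)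
  qed
  have "(\<Sum>i<n. M k i * (r i - s i)) = g * poly_trace (x k * z)" if k: "k < n" for k
  proof -
    have "g * poly_trace (x k * z) = poly_trace (h g * (x k * z))"
      using k z(1) by (intro poly_trace_scale[symmetric] integral_mult x_integral)
    also have "h g * (x k * z) = (\<Sum>i<n. h (r i - s i) * (x k * x i))"
      using arg_cong[OF eq, of "\<lambda>t. x k * t"] by (simp add: sum_distrib_left mult_ac)
    also have "poly_trace \<dots> = (\<Sum>i<n. poly_trace (h (r i - s i) * (x k * x i)))"
      using k by (intro tr_sum) (auto intro!: integral_mult x_integral)
    also have "\<dots> = (\<Sum>i<n. M k i * (r i - s i))"
      using k by (intro sum.cong refl)
        (subst poly_trace_scale, auto simp: M_def intro!: integral_mult x_integral)
    finally show ?thesis by simp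
  qed
  then have "g dvd (\<Sum>k<n. adj_n n M i k * (\<Sum>j<n. M k j * (r j - s j)))"
    by (intro dvd_sum) auto
  then have "g dvd disc x * (r i - s i)"
    using adj_n_cancels[OF assms(2), of M "\<lambda>j. r j - s j"] by (simp add: disc_def M_def[abs_def])
  then have "g dvd u * (disc x * (r i - s i)) + g * (v * (r i - s i))" by simp
  also have "\<dots> = (u * disc x + v * g) * (r i - s i)" by (simp add: algebra_simps)
  finally show ?thesis by (simp add: disc_bezout)
qed

end

section \<open>The \<open>Q\<close>-th power map as a combination of automorphisms\<close>

locale disc_coprime_frobenius = disc_coprime emb g u v x
  for emb :: "'f::{finite,field} poly fract \<Rightarrow> 'k::field" and g u v x +
  fixes Q :: nat
  assumes frob_poly: "\<And>a. g dvd a ^ Q - a"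
    and frob_sum: "\<And>(f :: nat \<Rightarrow> 'k) I. sum f I ^ Q = (\<Sum>i\<in>I. f i ^ Q)"
begin

text \<open>Cramer's solution modulo \<open>g\<close> of the system with the matrix of conjugates
  and right side \<open>x i ^ Q\<close>; the factor \<open>h u * \<delta>\<close> is the inverse of
  \<delta>.\<close>

definition frob_coeff :: "nat \<Rightarrow> 'k" where
  "frob_coeff j = h u * \<delta> * (\<Sum>i<n. adj_n n conj_mat j i * x i ^ Q)"

lemma frob_coeff_integral: "j < n \<Longrightarrow> frob_coeff j \<in> \<O>"
  unfolding frob_coeff_def
  by (intro \<O>.mult_closed \<O>.sum_closed h_integral det_integral adj_integral \<O>.power_closed x_integral) auto

lemma frob_basis:
  assumes "i < n"
  shows "(\<Sum>j<n. conj_mat i j * frob_coeff j) \<approx> x i ^ Q"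
proof -
  have "(\<Sum>j<n. conj_mat i j * frob_coeff j) =
      h u * \<delta> * (\<Sum>j<n. conj_mat i j * (\<Sum>k<n. adj_n n conj_mat j k * x k ^ Q))"
    unfolding frob_coeff_def by (subst (2) sum_distrib_left) (simp add: mult_ac)
  also have "\<dots> = h u * (\<delta> * (\<delta> * x i ^ Q))" 
    using adj_n_solves[OF assms, of conj_mat "\<lambda>k. x k ^ Q"] by (simp add: mult.assoc)
  also have "\<dots> \<approx> x i ^ Q" using assms by (intro disc_unit \<O>.power_closed x_integral)
  finally show ?thesis .
qed

text \<open>Modulo \<open>g\<close> both sides are additive and linear over polynomials, and they
  agree on the spanning family \<open>x\<close>.\<close>

lemma frob_expansion:
  assumes y: "y \<in> \<O>"
  shows "y ^ Q \<approx> (\<Sum>j<n. frob_coeff j * aut j y)"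
proof -
  obtain r where r: "y \<approx> (\<Sum>i<n. h (r i) * x i)" using poly_combination_exists[OF y] by blast
  let ?y = "\<Sum>i<n. h (r i) * x i"
  have "y ^ Q \<approx> ?y ^ Q"
    by (rule \<O>.cong_mod_power[OF y poly_combination_integral r])
  also have "?y ^ Q = (\<Sum>i<n. h (r i ^ Q) * x i ^ Q)"
    by (simp add: frob_sum power_mult_distrib h.hom_power)
  \<comment> \<open>The Carmichael property of \<open>g\<close> enters here: the polynomial
    coefficients equal their \<open>Q\<close>-th powers modulo \<open>g\<close>.\<close>
  also have "\<dots> \<approx> (\<Sum>i<n. h (r i) * x i ^ Q)"
    by (intro \<O>.cong_mod_sum \<O>.cong_mod_mult_right \<O>.power_closed x_integral
        h_cong_if_dvd frob_poly) auto
  also have "\<dots> \<approx> (\<Sum>i<n. h (r i) * (\<Sum>j<n. conj_mat i j * frob_coeff j))"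
    by (intro \<O>.cong_mod_sum \<O>.cong_mod_mult_left h_integral \<O>.cong_mod_sym[OF frob_basis]) auto
  also have "\<dots> = (\<Sum>j<n. frob_coeff j * aut j ?y)"
  proof -
    have "(\<Sum>i<n. h (r i) * (\<Sum>j<n. conj_mat i j * frob_coeff j)) =
        (\<Sum>i<n. \<Sum>j<n. frob_coeff j * (h (r i) * conj_mat i j))"
      by (simp add: sum_distrib_left mult_ac)
    also have "\<dots> = (\<Sum>j<n. \<Sum>i<n. frob_coeff j * (h (r i) * conj_mat i j))" by (rule sum.swap)
    also have "\<dots> = (\<Sum>j<n. frob_coeff j * aut j ?y)"
      by (intro sum.cong refl) (simp add: aut_poly_combination sum_distrib_left)
    finally show ?thesis .
  qed
  also have "\<dots> \<approx> (\<Sum>j<n. frob_coeff j * aut j y)"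
    by (intro \<O>.cong_mod_sum \<O>.cong_mod_mult_left frob_coeff_integral aut_cong
        \<O>.cong_mod_sym[OF r]) auto
  finally show ?thesis .
qed

text \<open>Expanding \<open>(z * x k) ^ Q\<close> directly, and as \<open>z ^ Q\<close> times the
  expansion of \<open>x k ^ Q\<close>, gives two combinations of the conjugates of
  \<open>x k\<close>; their coefficients agree modulo \<open>g\<close>.\<close>

lemma frob_coeff_aut:
  assumes z: "z \<in> \<O>" and j: "j < n"
  shows "frob_coeff j * z ^ Q \<approx> frob_coeff j * aut j z"
proof -
  \<comment> \<open>The difference of the two coefficient vectors, annihilated modulo
    \<open>g\<close> by the matrix of conjugates.\<close>
  define w where "w j = frob_coeff j * (aut j z - z ^ Q)" for j
  have "w j \<in> \<O>" if "j < n" for j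
    unfolding w_def using that
    by (intro \<O>.mult_closed frob_coeff_integral \<O>.diff_closed \<O>.power_closed z
        aut_integral[OF aut_in_auts z])
  moreover have "(\<Sum>j<n. conj_mat k j * w j) \<approx> 0" if k: "k < n" for k
  proof -
    have "(\<Sum>j<n. conj_mat k j * (frob_coeff j * aut j z)) = (\<Sum>j<n. frob_coeff j * aut j (z * x k))"
      by (intro sum.cong refl) (simp add: field_hom_mult[OF aut_field_hom] conj_mat_def)
    also have "\<dots> \<approx> (z * x k) ^ Q"
      using k by (intro \<O>.cong_mod_sym[OF frob_expansion] integral_mult z x_integral)
    also have "(z * x k) ^ Q = z ^ Q * x k ^ Q" by (rule power_mult_distrib)
    also have "\<dots> \<approx> z ^ Q * (\<Sum>j<n. conj_mat k j * frob_coeff j)"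
      using k by (intro \<O>.cong_mod_mult_left \<O>.power_closed z \<O>.cong_mod_sym[OF frob_basis])
    also have "\<dots> = (\<Sum>j<n. conj_mat k j * (frob_coeff j * z ^ Q))"
      by (simp add: sum_distrib_left mult_ac)
    finally show ?thesis
      by (simp add: w_def right_diff_distrib sum_subtractf \<O>.cong_mod_diff_iff)
  qed
  ultimately have "w j \<approx> 0" using conj_mat_cancel[of w j] j by blast
  then show ?thesis
    unfolding w_def right_diff_distrib \<O>.cong_mod_diff_iff by (rule \<O>.cong_mod_sym)
qed

lemma frob_coeff_aut_iterate:
  assumes "z \<in> \<O>" and j: "j < n"
  shows "frob_coeff j * z ^ (Q ^ k) \<approx> frob_coeff j * (aut j ^^ k) z"
  using assms(1)
proof (induction k arbitrary: z)
  case (Suc k)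
  have "z ^ (Q ^ k) \<in> \<O>" using Suc.prems by blast
  from frob_coeff_aut[OF this j]
  have "frob_coeff j * z ^ (Q ^ Suc k) \<approx> frob_coeff j * (aut j z) ^ (Q ^ k)"
    by (simp add: power_mult[symmetric] mult.commute field_hom_power[OF aut_field_hom[OF j]])
  also have "\<dots> \<approx> frob_coeff j * (aut j ^^ k) (aut j z)"
    by (rule Suc.IH[OF aut_integral[OF aut_in_auts[OF j] Suc.prems]])
  finally show ?case by (simp add: funpow_swap1)
qed simp

text \<open>The \<open>n\<close>-th iterate of each automorphism is the identity, so every
  coefficient satisfies the claim after multiplication; the coefficients add up to 1 modulo
  \<open>g\<close>.\<close>

lemma power_cong_self:
  assumes z: "z \<in> \<O>"
  shows "z ^ (Q ^ n) \<approx> z"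
proof -
  \<comment> \<open>The expansion of \<open>1 ^ Q\<close>.\<close>
  have one: "(\<Sum>j<n. frob_coeff j) \<approx> 1"
    using \<O>.cong_mod_sym[OF frob_expansion[of 1]] by (simp add: field_hom_1[OF aut_field_hom])
  have "z ^ (Q ^ n) = 1 * z ^ (Q ^ n)" by simp
  also have "\<dots> \<approx> (\<Sum>j<n. frob_coeff j) * z ^ (Q ^ n)"
    by (intro \<O>.cong_mod_mult_right \<O>.power_closed z \<O>.cong_mod_sym[OF one])
  also have "\<dots> = (\<Sum>j<n. frob_coeff j * z ^ (Q ^ n))" by (rule sum_distrib_right)
  also have "\<dots> \<approx> (\<Sum>j<n. frob_coeff j * z)"
    using frob_coeff_aut_iterate[OF z, of _ n] aut_funpow_degree[OF aut_in_auts]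
    by (intro \<O>.cong_mod_sum) simp
  also have "\<dots> = (\<Sum>j<n. frob_coeff j) * z" by (rule sum_distrib_right[symmetric])
  also have "\<dots> \<approx> 1 * z" by (rule \<O>.cong_mod_mult_right[OF z one])
  finally show ?thesis by simp
qed

end


section \<open>Carmichael polynomials in Galois extensions\<close>

context function_field_ext
begin

text \<open>Divisibility between polynomials descends from the integers: the quotient lies in the
  base field and is integral, hence is a polynomial.\<close>

lemma integral_quotient_poly:
  assumes "w \<in> \<O>" "e \<noteq> 0" "h e * w = h a"
  obtains c where "w = h c" "e * c = a"
proof -
  have "emb (to_fract a / to_fract e) * h e = h a"
    using assms(2) by (simp add: poly_emb_def emb_mult[symmetric])
  then have "w * h e = emb (to_fract a / to_fract e) * h e" using assms(3) by (simp add: mult.commute)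
  then have "w = emb (to_fract a / to_fract e)" using assms(2) by simp
  then have "w \<in> base_field emb" by (simp add: base_field_def)
  with assms(1) obtain c where c: "w = h c" by (rule base_field_integral)
  moreover have "e * c = a" using assms(3) by (simp add: c h_mult[symmetric])
  ultimately show ?thesis by (rule that)
qed

text \<open>A polynomial that is nonzero modulo \<open>g\<close> stays nonzero in the integers
  modulo \<open>g\<close>, so it is invertible there; this forces its common divisor with
  \<open>g\<close> to be a unit.\<close>

lemma field_poly_quotient_if_field_integer_quotient:
  assumes g: "g \<noteq> 0" and field: "field (\<O>.quotient_by (h g))"
  shows "field (subring_set.quotient_by UNIV g)"
proof -
  interpret P: subring_set "UNIV :: 'f poly set" by (rule subring_set_UNIV)
  have one: "\<not> \<O>.cong_mod (h g) 1 0"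
    and inverse: "\<And>a. a \<in> \<O> \<Longrightarrow> \<not> \<O>.cong_mod (h g) a 0 \<Longrightarrow> \<exists>c\<in>\<O>. \<O>.cong_mod (h g) (a * c) 1"
    using field unfolding \<O>.field_quotient_iff[OF h_integral] by blast+
  show ?thesis
    unfolding P.field_quotient_iff[OF UNIV_I]
  proof (intro conjI ballI impI)
    show "\<not> P.cong_mod g 1 0"
    proof
      assume "P.cong_mod g 1 0"
      then obtain z where "1 = g * z" unfolding P.cong_mod_def by auto
      then have "1 - 0 = h g * h z" by (metis diff_zero h_1 h_mult)
      then show False using one h_integral unfolding \<O>.cong_mod_def by blast
    qed
  next
    fix a :: "'f poly" assume a: "\<not> P.cong_mod g a 0"
    have "\<not> \<O>.cong_mod (h g) (h a) 0"
    proof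
      assume "\<O>.cong_mod (h g) (h a) 0"
      then obtain w where w: "w \<in> \<O>" "h g * w = h a" unfolding \<O>.cong_mod_def by auto
      from integral_quotient_poly[OF w(1) g w(2)] obtain c where "g * c = a" by blast
      then show False using a unfolding P.cong_mod_def by auto
    qed
    then obtain c where c: "c \<in> \<O>" "\<O>.cong_mod (h g) (h a * c) 1" using inverse[of "h a"] by auto
    then obtain z where z: "z \<in> \<O>" "h a * c - 1 = h g * z" unfolding \<O>.cong_mod_def by blast
    \<comment> \<open>The inverse \<open>c\<close> need not be a polynomial. It only shows that
      \<open>e\<close> divides 1; the polynomial inverse of \<open>a\<close> is built from
      \<open>s\<close>.\<close>
    obtain s t e where e: "s * a + t * g = e" "e dvd a" "e dvd g" using poly_bezout[OF g] .
    obtain a' g' where ag: "a = e * a'" "g = e * g'" using e(2,3) unfolding dvd_def by blast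
    have "h e * (h a' * c - h g' * z) = h 1"
      using z(2) by (simp add: ag h_mult algebra_simps)
    moreover have "e \<noteq> 0" using g ag by auto
    moreover have "h a' * c - h g' * z \<in> \<O>"
      by (intro \<O>.diff_closed integral_mult h_integral c(1) z(1))
    ultimately obtain k where k: "e * k = 1" using integral_quotient_poly by metis
    have "a * (s * k) - 1 = g * (- (t * k))"
      using k unfolding e(1)[symmetric] by (simp add: algebra_simps eq_neg_iff_add_eq_0)
    then show "\<exists>c\<in>UNIV. P.cong_mod g (a * c) 1" unfolding P.cong_mod_def by blast
  qed
qed

text \<open>The characteristic of the finite field vanishes in \<open>'k\<close> too, so
  \<open>'k\<close> has positive characteristic.\<close>

lemma CHAR_prime_ext: "prime CHAR('k)"
proof -
  have "of_nat CHAR('f) = (0 :: 'f poly)" using of_nat_CHAR[where 'a = "'f poly"] by simp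
  then have "of_nat CHAR('f) = (0 :: 'k)" by (metis h.hom_of_nat h_0)
  then have "CHAR('k) dvd CHAR('f)" by (simp add: of_nat_eq_0_iff_char_dvd)
  moreover have "CHAR('f) > 0" by (rule finite_imp_CHAR_pos) simp
  ultimately have "CHAR('k) > 0" by (auto intro: gr0I)
  then show ?thesis by (rule prime_CHAR_semidom)
qed

lemma of_nat_CHAR_ext_poly: "of_nat CHAR('k) = (0 :: 'f poly)"
  by (metis h.hom_of_nat h_eq_0_iff of_nat_CHAR)

end

theorem theorem5p1:
  fixes g :: "'f::{finite,field} poly"
    and emb :: "'f poly fract \<Rightarrow> 'k::field"
  assumes "carmichael_poly g"
    and "field_hom emb"
    and "galois_ext emb"
    and "rel_prime_ideal (discriminant_ideal emb) g"
  shows "carmichael_in emb (poly_emb emb g)"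
proof -
  interpret galois_function_field emb by unfold_locales (use assms in auto)
  interpret P: subring_set "UNIV :: 'f poly set" by (rule subring_set_UNIV)
  define Q where "Q = card (carrier (P.quotient_by g))"
  have fin: "finite (carrier (P.quotient_by g))" and nfield: "\<not> field (P.quotient_by g)"
    and pow: "\<And>a. P.cong_mod g (a ^ Q) a"
    using assms(1) unfolding carmichael_poly_def poly_ring_def P.carmichael_ideal_iff[OF UNIV_I] Q_def
    by auto
  obtain R where R: "bij_betw (P.residue_class g) R (carrier (P.quotient_by g))"
    "\<And>a. \<exists>r\<in>R. P.cong_mod g a r" "\<And>r s. r \<in> R \<Longrightarrow> s \<in> R \<Longrightarrow> P.cong_mod g r s \<Longrightarrow> r = s"
    by (rule P.quotient_representatives[OF UNIV_I, of g]) blast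
  have card_R: "card R = Q" and fin_R: "finite R"
    using bij_betw_same_card[OF R(1)] bij_betw_finite[OF R(1)] fin by (simp_all add: Q_def)
  have g: "g \<noteq> 0"
  proof
    assume "g = 0"
    \<comment> \<open>Congruence modulo 0 is equality, so the finite set \<open>R\<close> would
      contain all polynomials.\<close>
    then have "a \<in> R" for a using R(2)[of a] unfolding P.cong_mod_def by auto
    then have "R = UNIV" by blast
    then show False using fin_R infinite_UNIV_poly[where 'a = 'f] by simp
  qed
  obtain k where k: "Q = CHAR('k) ^ k"
    unfolding Q_def
    using P.card_quotient_prime_power[OF UNIV_I fin CHAR_prime_ext of_nat_CHAR_ext_poly] by blast
  obtain x u v where x: "\<And>i. i < n \<Longrightarrow> x i \<in> \<O>" "u * disc x + v * g = 1"
    using integral_family_disc_coprime[OF assms(4) g dvd_refl] by blast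
  \<comment> \<open>The two properties of \<open>Q\<close> come from different sources: the
    congruence from the Carmichael property, additivity from \<open>Q\<close> being a power of the
    characteristic.\<close>
  interpret disc_coprime_frobenius emb g u v x Q
  proof unfold_locales
    show "g dvd a ^ Q - a" for a using pow[of a] by (auto simp: P.cong_mod_def dvd_def)
    show "sum f I ^ Q = (\<Sum>i\<in>I. f i ^ Q)" for f :: "nat \<Rightarrow> 'k" and I
      by (rule freshmans_dream_sum'[OF CHAR_prime_ext k])
  qed (use x in auto)
  \<comment> \<open>Coordinate vectors with entries among the representatives \<open>R\<close>. The
    extensional function space fixes the values outside \<open>{..<n}\<close>, so there are exactly
    \<open>Q ^ n\<close> of them.\<close>
  let ?S = "{..<n} \<rightarrow>\<^sub>E R" and ?f = "\<lambda>r. \<Sum>i<n. h (r i) * x i"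
  have bij: "bij_betw (\<lambda>r. \<O>.residue_class (h g) (?f r)) ?S (carrier (\<O>.quotient_by (h g)))"
  proof (rule \<O>.bij_betw_quotient[OF h_integral])
    show "?f ` ?S \<subseteq> \<O>" using poly_combination_integral by auto
  next
    fix y assume "y \<in> \<O>"
    then obtain c where c: "y \<approx> ?f c" using poly_combination_exists by blast
    obtain \<rho> where \<rho>: "\<And>a. \<rho> a \<in> R" "\<And>a. P.cong_mod g a (\<rho> a)" using R(2) by metis
    have "?f c \<approx> ?f (\<lambda>i\<in>{..<n}. \<rho> (c i))"
    proof (intro \<O>.cong_mod_sum \<O>.cong_mod_mult_right)
      fix i assume i: "i \<in> {..<n}"
      show "h (c i) \<approx> h ((\<lambda>i\<in>{..<n}. \<rho> (c i)) i)"
        using \<rho>(2)[of "c i"] i by (auto intro!: h_cong_if_dvd simp: P.cong_mod_def dvd_def)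
    qed (use x in auto)
    with c have "y \<approx> ?f (\<lambda>i\<in>{..<n}. \<rho> (c i))" by (rule \<O>.cong_mod_trans)
    moreover have "(\<lambda>i\<in>{..<n}. \<rho> (c i)) \<in> ?S" using \<rho>(1) by auto
    ultimately show "\<exists>r\<in>?S. y \<approx> ?f r" by blast
  next
    fix r s assume rs: "r \<in> ?S" "s \<in> ?S" "?f r \<approx> ?f s"
    show "r = s"
    proof (rule PiE_ext[OF rs(1,2)])
      fix i assume i: "i \<in> {..<n}"
      then have "g dvd r i - s i" using poly_combination_unique[OF rs(3)] by simp
      then have "P.cong_mod g (r i) (s i)" by (auto simp: P.cong_mod_def dvd_def)
      then show "r i = s i" using R(3) rs(1,2) i by (meson PiE_mem)
    qed
  qed
  have "finite (carrier (\<O>.quotient_by (h g)))"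
    using bij_betw_finite[OF bij] fin_R by (simp add: finite_PiE)
  moreover have "card (carrier (\<O>.quotient_by (h g))) = Q ^ n"
    using bij_betw_same_card[OF bij] by (simp add: card_PiE card_R)
  moreover have "\<not> field (\<O>.quotient_by (h g))"
    using nfield field_poly_quotient_if_field_integer_quotient[OF g] by blast
  ultimately show ?thesis
    using power_cong_self
    unfolding carmichael_in_def O_ring_def \<O>.carmichael_ideal_iff[OF h_integral] by simp
qed

end
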